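(* Let $(X,\Sigma,\mu,G)$ be a measure-preserving action of a countable amenable group $G$ on a standard probability space. Let $\mathcal P$ be a finite measurable partition of $X$. Fix a multiorder $(\tilde{\mathcal O},\Sigma_{\tilde{\mathcal O}},\nu,G)$ on $G$. A set $A$ belongs to the Pinsker sigma-algebra $\Pi_G(\mathcal P)$ of the $G$-process generated by $\mathcal P$ if and only if $$A\in\bigcap_{n\ge1}\mathcal P^{(-\infty,-n]^{\prec}}$$ for $\nu$-almost every $\prec\,\in\tilde{\mathcal O}$. Equivalently, for $\nu$-almost every $\prec\,\in\tilde{\mathcal O}$, $$\Pi_G(\mathcal P)=\bigcap_{g\in G}\ \bigcap_{n\ge1}\mathcal P^{(-\infty,-n]^{g(\prec)}}.$$
   Context: Sigma-algebras are understood modulo $\mu$-null sets. A countable amenable group means an infinite countable discrete group $G$ (unit $e$) in which there is a Følner sequence, i.e. a sequence of finite subsets $F_n\subset G$ with $\lim_n |F_n\cap gF_n|/|F_n|=1$ for every $g\in G$. A linear order $\prec$ on $G$ is of type $\mathbb Z$ if every order interval $[a,b]^{\prec}=\{a,b\}\cup\{g\in G: a\prec g\prec b\}$ ($a\prec b$) is finite and $G$ has no minimal or maximal element. The set $\tilde{\mathcal O}$ of all orders of type $\mathbb Z$ on $G$ is a Borel subset of $\{0,1\}^{G\times G}$ (relations identified with their indicator functions, product topology), with the inherited Borel sigma-algebra $\Sigma_{\tilde{\mathcal O}}$. $G$ acts on $\tilde{\mathcal O}$ by: $\prec'=g(\prec)$ where $a\prec' b\iff ag\prec bg$. A multiorder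 on $G$ is the measure-preserving action $(\tilde{\mathcal O},\Sigma_{\tilde{\mathcal O}},\nu,G)$, where $\nu$ is a $G$-invariant Borel probability measure on $\tilde{\mathcal O}$. The multiorder is not assumed to be a factor of $(X,\mu,G)$. For $\prec\,\in\tilde{\mathcal O}$, $i\mapsto i^{\prec}$ denotes the unique bijection $\mathbb Z\to G$ such that $0^{\prec}=e$ and $(i+1)^{\prec}$ is the successor of $i^{\prec}$ for all $i$; $(-\infty,-n]^{\prec}=\{i^{\prec}: i\le -n\}$. For $D\subset G$, $\mathcal P^D=\bigvee_{g\in D}g^{-1}(\mathcal P)$ (the sigma-algebra generated, when $D$ is infinite). Entropy: for a finite measurable partition $\mathcal R$, $h(\mu,G,\mathcal R)=\lim_n\frac1{|F_n|}H(\mu,\mathcal R^{F_n})$, where $(F_n)$ is any Følner sequence and $H(\mu,\mathcal Q)=-\sum_{Q\in\mathcal Q}\mu(Q)\log\mu(Q)$. $\Pi_G(\mathcal P)$ consists of all sets $A\in\mathcal P^G$ with $h(\mu,G,\{A,A^c\})=0$, i.e. it is the Pinsker sigma-algebra of the factor of $(X,\mu,G)$ generated by $\mathcal P$. *)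

theory Defs
  imports "HOL-Probability.Probability"
begin

text \<open>The group \<open>G\<close> is a type of class \<^class>\<open>group_add\<close>. Despite the additive notation this class
  does not include commutativity: the product \<open>gh\<close>, the inverse and the unit \<open>e\<close> are written
  \<open>g + h\<close>, \<open>- g\<close> and \<open>0\<close>, and all products below are in the order required for a
  noncommutative \<open>G\<close>.\<close>

definition folner_sequence :: "(nat \<Rightarrow> 'g::group_add set) \<Rightarrow> bool" where
  "folner_sequence F \<longleftrightarrow> (\<forall>n. finite (F n)) \<and>
     (\<forall>g. (\<lambda>n. real (card (F n \<inter> (\<lambda>x. g + x) ` F n)) / real (card (F n))) \<longlonglongrightarrow> 1)"

definition amenable_group :: "'g::group_add itself \<Rightarrow> bool" where
  "amenable_group _ \<longleftrightarrow> (\<exists>F :: nat \<Rightarrow> 'g set. folner_sequence F)"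

text \<open>Standard probability spaces in the sense of Lebesgue and Rokhlin, not necessarily complete:
  on a conull measurable set there is a Polish topology whose Borel sets are measurable and
  exhaust all measurable sets up to null sets. This comprises every standard Borel space with a
  probability measure as well as its completion.\<close>

definition standard_prob_space :: "'x measure \<Rightarrow> bool" where
  "standard_prob_space M \<longleftrightarrow> prob_space M \<and>
     (\<exists>X. completely_metrizable_space X \<and> second_countable X \<and>
        topspace X \<in> sets M \<and> measure M (topspace X) = 1 \<and>
        sigma_sets (topspace X) {U. openin X U} \<subseteq> sets M \<and>
        (\<forall>A\<in>sets M. \<exists>B\<in>sigma_sets (topspace X) {U. openin X U}. B \<subseteq> A \<and> measure M (A - B) = 0))"

definition pmp_action :: "'x measure \<Rightarrow> ('g::group_add \<Rightarrow> 'x \<Rightarrow> 'x) \<Rightarrow> bool" where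
  "pmp_action M T \<longleftrightarrow> prob_space M \<and>
     (\<forall>g. T g \<in> M \<rightarrow>\<^sub>M M \<and> distr M M (T g) = M) \<and>
     (\<forall>x\<in>space M. T 0 x = x \<and> (\<forall>g h. T (g + h) x = T g (T h x)))"


subsection \<open>Partitions, entropy and the Pinsker sigma-algebra\<close>

definition measurable_partition :: "'x measure \<Rightarrow> 'x set set \<Rightarrow> bool" where
  "measurable_partition M P \<longleftrightarrow> finite P \<and> partition_on (space M) P \<and> P \<subseteq> sets M"

text \<open>The partition \<open>g\<inverse>(R)\<close>, and the partition \<open>R\<^sup>D = \<Or>\<^bsub>g \<in> D\<^esub> g\<inverse>(R)\<close> for finite \<open>D\<close>.\<close>

definition pullback :: "'x measure \<Rightarrow> ('g \<Rightarrow> 'x \<Rightarrow> 'x) \<Rightarrow> 'x set set \<Rightarrow> 'g \<Rightarrow> 'x set set" where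
  "pullback M T R g = (\<lambda>A. T g -` A \<inter> space M) ` R"

definition join_partition ::
    "'x measure \<Rightarrow> ('g \<Rightarrow> 'x \<Rightarrow> 'x) \<Rightarrow> 'x set set \<Rightarrow> 'g set \<Rightarrow> 'x set set" where
  "join_partition M T R D = common_refinement (pullback M T R ` D)"

text \<open>The sigma-algebra \<open>P\<^sup>D\<close>, for arbitrary \<open>D\<close>. As sigma-algebras are understood modulo null sets,
  it consists of all measurable sets that agree with a set of the generated sigma-algebra up to
  measure zero.\<close>

definition join_algebra ::
    "'x measure \<Rightarrow> ('g \<Rightarrow> 'x \<Rightarrow> 'x) \<Rightarrow> 'x set set \<Rightarrow> 'g set \<Rightarrow> 'x set set" where
  "join_algebra M T P D =
     {A \<in> sets M. \<exists>B\<in>sigma_sets (space M) (\<Union>g\<in>D. pullback M T P g). measure M (sym_diff A B) = 0}"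

text \<open>Since \<open>ln 0 = 0\<close> here, the convention \<open>0 log 0 = 0\<close> holds.\<close>

definition partition_entropy :: "'x measure \<Rightarrow> 'x set set \<Rightarrow> real" where
  "partition_entropy M Q = - (\<Sum>A\<in>Q. measure M A * ln (measure M A))"

text \<open>The common limit along all Folner sequences.\<close>

definition dyn_entropy ::
    "'x measure \<Rightarrow> ('g::group_add \<Rightarrow> 'x \<Rightarrow> 'x) \<Rightarrow> 'x set set \<Rightarrow> real" where
  "dyn_entropy M T R = (THE h. \<forall>F. folner_sequence F \<longrightarrow>
     (\<lambda>n. partition_entropy M (join_partition M T R (F n)) / real (card (F n))) \<longlonglongrightarrow> h)"

definition pinsker_algebra ::
    "'x measure \<Rightarrow> ('g::group_add \<Rightarrow> 'x \<Rightarrow> 'x) \<Rightarrow> 'x set set \<Rightarrow> 'x set set" where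
  "pinsker_algebra M T P =
     {A \<in> join_algebra M T P UNIV. dyn_entropy M T {A, space M - A} = 0}"


subsection \<open>Orders of type Z and multiorders\<close>

text \<open>A relation on \<open>G\<close> is identified with its indicator function on \<open>G \<times> G\<close>, the topology being the
  product topology with \<^typ>\<open>bool\<close> discrete.\<close>

type_synonym 'g order_rel = "'g \<times> 'g \<Rightarrow> bool"

definition order_interval :: "'g order_rel \<Rightarrow> 'g \<Rightarrow> 'g \<Rightarrow> 'g set" where
  "order_interval r a b = {a, b} \<union> {g. r (a, g) \<and> r (g, b)}"

definition Z_orders :: "'g order_rel set" where
  "Z_orders = {r. strict_linear_order_on UNIV {p. r p} \<and>
     (\<forall>a b. r (a, b) \<longrightarrow> finite (order_interval r a b)) \<and>
     (\<forall>a. \<exists>b. r (b, a)) \<and> (\<forall>a. \<exists>b. r (a, b))}"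

definition order_action :: "'g::group_add \<Rightarrow> 'g order_rel \<Rightarrow> 'g order_rel" where
  "order_action g r = (\<lambda>(a, b). r (a + g, b + g))"

definition order_algebra :: "'g order_rel measure" where
  "order_algebra = restrict_space borel Z_orders"

definition multiorder :: "'g::group_add order_rel measure \<Rightarrow> bool" where
  "multiorder N \<longleftrightarrow> sets N = sets order_algebra \<and> pmp_action N order_action"

definition is_successor :: "'g order_rel \<Rightarrow> 'g \<Rightarrow> 'g \<Rightarrow> bool" where
  "is_successor r a b \<longleftrightarrow> r (a, b) \<and> \<not> (\<exists>c. r (a, c) \<and> r (c, b))"

text \<open>The enumeration \<open>i \<mapsto> i\<^sup>\<prec>\<close> of \<open>G\<close>, and the ray \<open>(-\<infinity>, -n]\<^sup>\<prec>\<close>.\<close>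

definition order_enum :: "'g::group_add order_rel \<Rightarrow> int \<Rightarrow> 'g" where
  "order_enum r = (THE f. bij f \<and> f 0 = 0 \<and> (\<forall>i. is_successor r (f i) (f (i + 1))))"

definition order_past :: "'g::group_add order_rel \<Rightarrow> nat \<Rightarrow> 'g set" where
  "order_past r n = order_enum r ` {i. i \<le> - int n}"

end

theory Submission
  imports Defs "HOL-Real_Asymp.Real_Asymp"
begin

text \<open>
  Write \<open>e(Q | C, \<prec>)\<close> for the conditional entropy of \<open>Q\<close> given \<open>C\<^sup>D\<close>, where \<open>D\<close> is the set of all
  \<open>h \<prec> 0\<close>. Expanding \<open>H(C\<^sup>F)\<close> by the chain rule in the order \<open>\<prec>\<close> and averaging over the
  multiorder, invariance of \<open>\<nu>\<close> shows that \<open>H(C\<^sup>F) / |F|\<close> converges along every Folner sequence to the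
  mean \<open>h(C)\<close> of \<open>e(C | C, \<prec>)\<close>, and that \<open>h(C) |F|\<close> is at most \<open>H(C\<^sup>F)\<close> for every finite \<open>F\<close>.

  Let \<open>R = {A, A\<^sup>c}\<close> have zero entropy, with \<open>A\<close> in \<open>P\<^sup>G\<close>. Then \<open>e(R | R, \<prec>) = 0\<close> almost surely, and
  \<open>h(P \<or> R) = h(P)\<close> forces \<open>e(P | P \<or> R, \<prec>) = e(P | P, \<prec>)\<close> almost surely. By invariance both hold at all
  \<open>g(\<prec>)\<close>, so that \<open>R\<close> is independent of any finite block of the \<open>P\<close>-process conditionally on the
  \<open>P\<close>-past before that block. As \<open>A\<close> is approximated by such a past joined with such a block, it belongs
  to the past. Separability of \<open>P\<^sup>G\<close> makes the exceptional set independent of \<open>A\<close>.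

  Conversely, if all translates of \<open>A\<close> lie in the remote past of \<open>P\<close> along \<open>\<prec>\<close>, the chain rule gives
  \<open>H((P \<or> R)\<^sup>F) \<ge> H(R\<^sup>F) + \<Sum>\<^bsub>g \<in> F\<^esub> e(P | P, g(\<prec>))\<close>. For almost every \<open>\<prec>\<close> the last sum is
  asymptotically \<open>H(P\<^sup>F)\<close> along a subsequence of a fixed Folner sequence: the difference is nonnegative and
  its mean is \<open>o(|F|)\<close>. Hence \<open>h(P) = h(P \<or> R) \<ge> h(R) + h(P)\<close>.
\<close>

section \<open>Entropy of finite families of events\<close>

definition cell :: "'x measure \<Rightarrow> 'x set set \<Rightarrow> 'x \<Rightarrow> 'x set" where
  "cell M C x = {y \<in> space M. \<forall>A\<in>C. x \<in> A \<longleftrightarrow> y \<in> A}"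

text \<open>A finite family of events stands for the partition into its atoms, so that unions of families
  are joins of partitions.\<close>

definition ent :: "'x measure \<Rightarrow> 'x set set \<Rightarrow> real" where
  "ent M C = partition_entropy M (cell M C ` space M)"

text \<open>Taken as a difference of entropies, so that the chain rule is an identity between real
  numbers and no conditional measures appear.\<close>

definition cond_ent :: "'x measure \<Rightarrow> 'x set set \<Rightarrow> 'x set set \<Rightarrow> real" where
  "cond_ent M C D = ent M (C \<union> D) - ent M D"

abbreviation finite_events :: "'x measure \<Rightarrow> 'x set set \<Rightarrow> bool" where
  "finite_events M C \<equiv> finite C \<and> C \<subseteq> sets M"

lemma mem_cell_self: "x \<in> space M \<Longrightarrow> x \<in> cell M C x"
  by (simp add: cell_def)

lemma cell_subset_space: "cell M C x \<subseteq> space M"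
  by (auto simp: cell_def)

lemma cell_eq_iff:
  "x \<in> space M \<Longrightarrow> y \<in> space M \<Longrightarrow>
    cell M C x = cell M C y \<longleftrightarrow> (\<forall>A\<in>C. x \<in> A \<longleftrightarrow> y \<in> A)"
proof
  assume xy: "x \<in> space M" "y \<in> space M" and "cell M C x = cell M C y"
  with mem_cell_self[of y M C] have "y \<in> cell M C x" by simp
  then show "\<forall>A\<in>C. x \<in> A \<longleftrightarrow> y \<in> A" by (simp add: cell_def)
qed (simp add: cell_def)

lemma mem_cell_iff:
  assumes "x \<in> space M"
  shows "y \<in> cell M C x \<longleftrightarrow> y \<in> space M \<and> cell M C y = cell M C x"
proof (cases "y \<in> space M")
  case True
  then show ?thesis
    unfolding cell_eq_iff[OF True assms] by (simp add: cell_def eq_commute)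
qed (simp add: cell_def)

lemma cell_Un: "cell M (C \<union> D) x = cell M C x \<inter> cell M D x"
  by (auto simp: cell_def)

lemma cell_vimage:
  "x \<in> space M \<Longrightarrow> cell M C -` {cell M C x} \<inter> space M = cell M C x"
  by (intro set_eqI) (simp add: mem_cell_iff conj_commute)

text \<open>A cell depends only on which members of \<open>C\<close> contain the point, so there are
  at most as many cells as subsets of \<open>C\<close>.\<close>

lemma finite_cells: "finite C \<Longrightarrow> finite (cell M C ` S)"
proof -
  assume "finite C"
  have "cell M C ` S \<subseteq> (\<lambda>B. {y \<in> space M. \<forall>A\<in>C. A \<in> B \<longleftrightarrow> y \<in> A}) ` Pow C"
  proof
    fix s assume "s \<in> cell M C ` S"
    then obtain x where "s = cell M C x" by auto
    then show "s \<in> (\<lambda>B. {y \<in> space M. \<forall>A\<in>C. A \<in> B \<longleftrightarrow> y \<in> A}) ` Pow C"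
      by (intro image_eqI[of _ _ "{A\<in>C. x \<in> A}"]) (auto simp: cell_def)
  qed
  then show ?thesis
    by (rule finite_subset) (simp add: \<open>finite C\<close>)
qed

lemma cell_sigma_sets:
  assumes "finite C" "C \<subseteq> Pow (space M)"
  shows "cell M C x \<in> sigma_sets (space M) C"
proof -
  interpret sigma_algebra "space M" "sigma_sets (space M) C"
    using assms(2) by (rule sigma_algebra_sigma_sets)
  have "cell M C x = space M \<inter> (\<Inter>A\<in>C. if x \<in> A then A else space M - A)"
    by (auto simp: cell_def split: if_splits)
  also have "\<dots> \<in> sigma_sets (space M) C"
  \<comment> \<open>\<open>finite_INT\<close> asks for a nonempty index set; without events the only
    cell is the whole space.\<close>
  proof (cases "C = {}")
    case False
    then show ?thesis
      by (intro Int finite_INT assms) (auto intro: sigma_sets.Basic sigma_sets.Compl)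
  qed (simp add: sigma_sets_top)
  finally show ?thesis .
qed

lemma cell_sets: "finite_events M C \<Longrightarrow> cell M C x \<in> sets M"
  using cell_sigma_sets[of C M x] sets.sigma_sets_subset[of C M] sets.space_closed[of M] by blast

lemma simple_function_cell: "finite_events M C \<Longrightarrow> simple_function M (cell M C)"
  unfolding simple_function_def by (auto simp: finite_cells cell_vimage cell_sets)

section \<open>Entropy as the mean of the information function\<close>

context prob_space
begin

text \<open>Both sides are the expectation of a finite-valued function. This puts entropies of
  several families over one joint variable, where they can be compared term by term.\<close>

lemma sum_prob_vimage:
  fixes \<phi> :: "'b \<Rightarrow> real"
  assumes "simple_function M W"
  shows "(\<Sum>w\<in>W ` space M. prob (W -` {w} \<inter> space M) * \<phi> w) = (\<integral>x. \<phi> (W x) \<partial>M)"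
proof -
  have fin: "finite (W ` space M)" and m: "\<And>w. W -` {w} \<inter> space M \<in> sets M"
    using assms by (auto dest: simple_functionD)
  have "(\<integral>x. \<phi> (W x) \<partial>M)
      = (\<integral>x. (\<Sum>w\<in>W ` space M. \<phi> w * indicator (W -` {w} \<inter> space M) x) \<partial>M)"
  proof (intro Bochner_Integration.integral_cong refl)
    fix x assume x: "x \<in> space M"
    have "(\<Sum>w\<in>W ` space M. \<phi> w * indicator (W -` {w} \<inter> space M) x)
        = (\<Sum>w\<in>W ` space M. if w = W x then \<phi> w else 0)"
      using x by (intro sum.cong) (auto simp: indicator_def)
    with fin x show "\<phi> (W x) = (\<Sum>w\<in>W ` space M. \<phi> w * indicator (W -` {w} \<inter> space M) x)"
      by simp
  qed
  also have "\<dots> = (\<Sum>w\<in>W ` space M. (\<integral>x. \<phi> w * indicator (W -` {w} \<inter> space M) x \<partial>M))"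
    using m by (intro Bochner_Integration.integral_sum integrable_mult_right) (auto simp: emeasure_eq_measure)
  also have "\<dots> = (\<Sum>w\<in>W ` space M. prob (W -` {w} \<inter> space M) * \<phi> w)"
    using m by (intro sum.cong) (auto simp: mult.commute)
  finally show ?thesis by simp
qed

lemma sum_cells:
  fixes \<phi> :: "'a set \<Rightarrow> real"
  assumes "finite_events M C"
  shows "(\<Sum>s\<in>cell M C ` space M. prob s * \<phi> s) = (\<integral>x. \<phi> (cell M C x) \<partial>M)"
  unfolding sum_prob_vimage[OF simple_function_cell[OF assms], symmetric]
  by (intro sum.cong) (auto simp: cell_vimage)

lemma ent_eq_integral:
  "finite_events M C \<Longrightarrow> ent M C = - (\<integral>x. ln (prob (cell M C x)) \<partial>M)"
  unfolding ent_def partition_entropy_def by (simp add: sum_cells)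

lemma ent_empty: "ent M {} = 0"
proof -
  have "cell M {} ` space M = {space M}"
    using not_empty by (auto simp: cell_def)
  then show ?thesis by (simp add: ent_def partition_entropy_def prob_space)
qed

end

text \<open>This is nonnegativity of the conditional mutual information of \<open>C\<close> and
  \<open>E\<close> given \<open>D\<close>. With base \<open>exp 1\<close> the library's
  \<open>log b\<close> becomes the \<open>ln\<close> of \<open>partition_entropy\<close>.\<close>

lemma (in information_space) ent_submodular_base_e:
  assumes b: "b = exp 1" and C: "finite_events M C" and D: "finite_events M D" and E: "finite_events M E"
  shows "ent M (C \<union> E \<union> D) + ent M D \<le> ent M (C \<union> D) + ent M (E \<union> D)"
proof -
  let ?X = "cell M C" and ?Y = "cell M E" and ?Z = "cell M D"
  note sf = simple_function_cell[OF C] simple_function_cell[OF D] simple_function_cell[OF E]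
  \<comment> \<open>All four entropies are expectations over the joint variable \<open>W\<close>;
    \<open>?xz\<close>, \<open>?yz\<close> and \<open>?z\<close> are the marginal probabilities of
    its values.\<close>
  define W where "W x = (?X x, ?Y x, ?Z x)" for x
  let ?p = "\<lambda>w. prob (W -` {w} \<inter> space M)"
  let ?xz = "\<lambda>(x, y, z). prob ((\<lambda>x. (?X x, ?Z x)) -` {(x, z)} \<inter> space M)"
  let ?yz = "\<lambda>(x, y, z). prob ((\<lambda>x. (?Y x, ?Z x)) -` {(y, z)} \<inter> space M)"
  let ?z = "\<lambda>(x, y, z). prob (?Z -` {z} \<inter> space M)"
  have sW: "simple_function M W"
    unfolding W_def by (intro simple_function_Pair sf)
  have W: "?p (W x) = prob (cell M (C \<union> E \<union> D) x)" "?xz (W x) = prob (cell M (C \<union> D) x)"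
    "?yz (W x) = prob (cell M (E \<union> D) x)" "?z (W x) = prob (cell M D x)" if "x \<in> space M" for x
    unfolding W_def prod.case using that
    by (intro arg_cong[where f=prob] set_eqI; simp add: mem_cell_iff cell_Un conj_ac; blast)+
  have "0 \<le> \<I>(?X ; ?Y | ?Z)"
    by (intro conditional_mutual_information_nonneg sf)
  also have "\<dots> = (\<Sum>(x, y, z)\<in>W ` space M. ?p (x, y, z) * log b
      (?p (x, y, z) / (?xz (x, y, z) * (?yz (x, y, z) / ?z (x, y, z)))))"
    unfolding W_def prod.case
    by (intro conditional_mutual_information_eq simple_distributedI simple_function_Pair sf) auto
  also have "\<dots> = (\<Sum>w\<in>W ` space M. ?p w * ln (?p w) - ?p w * ln (?xz w) - ?p w * ln (?yz w) + ?p w * ln (?z w))"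
  proof (intro sum.cong refl)
    fix w assume "w \<in> W ` space M"
    then obtain x where x: "x \<in> space M" "w = W x" by auto
    obtain u v t where w: "w = (u, v, t)" by (cases w)
    show "(case w of (x, y, z) \<Rightarrow> ?p (x, y, z) * log b
      (?p (x, y, z) / (?xz (x, y, z) * (?yz (x, y, z) / ?z (x, y, z)))))
      = ?p w * ln (?p w) - ?p w * ln (?xz w) - ?p w * ln (?yz w) + ?p w * ln (?z w)"
    \<comment> \<open>A null value contributes zero to both sides. Otherwise all marginals are
      positive and the logarithm of the quotient splits.\<close>
    proof (cases "?p w = 0")
      case False
      then have p: "?p w > 0" by (simp add: zero_less_measure_iff)
      have "?p w \<le> ?xz w" "?p w \<le> ?yz w" "?p w \<le> ?z w"
        unfolding x(2) W[OF x(1)]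
        by (intro finite_measure_mono cell_sets; use C D E in \<open>auto simp: cell_def\<close>)+
      with p have q: "?xz w > 0" "?yz w > 0" "?z w > 0" by linarith+
      have "log b (?p w / (?xz w * (?yz w / ?z w))) = ln (?p w) - ln (?xz w) - ln (?yz w) + ln (?z w)"
        using p q by (simp add: b log_def ln_div ln_mult)
      then have "?p w * log b (?p w / (?xz w * (?yz w / ?z w)))
          = ?p w * ln (?p w) - ?p w * ln (?xz w) - ?p w * ln (?yz w) + ?p w * ln (?z w)"
        by (simp only: ring_distribs)
      then show ?thesis unfolding w prod.case .
    qed (simp add: w)
  qed
  also have "\<dots> = (\<integral>x. ln (?p (W x)) \<partial>M) - (\<integral>x. ln (?xz (W x)) \<partial>M)
      - (\<integral>x. ln (?yz (W x)) \<partial>M) + (\<integral>x. ln (?z (W x)) \<partial>M)"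
    by (simp add: sum.distrib sum_subtractf sum_prob_vimage[OF sW, of "\<lambda>w. ln (?p w)"]
        sum_prob_vimage[OF sW, of "\<lambda>w. ln (?xz w)"] sum_prob_vimage[OF sW, of "\<lambda>w. ln (?yz w)"]
        sum_prob_vimage[OF sW, of "\<lambda>w. ln (?z w)"])
  also have "\<dots> = - ent M (C \<union> E \<union> D) + ent M (C \<union> D) + ent M (E \<union> D) - ent M D"
    using C D E by (simp add: ent_eq_integral W cong: Bochner_Integration.integral_cong)
  finally show ?thesis by simp
qed

section \<open>Rules for conditional entropy\<close>

context prob_space
begin

lemma ent_submodular:
  assumes "finite_events M C" and "finite_events M D" and "finite_events M E"
  shows "ent M (C \<union> E \<union> D) + ent M D \<le> ent M (C \<union> D) + ent M (E \<union> D)"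
proof -
  interpret information_space M "exp 1" by standard simp
  show ?thesis by (rule ent_submodular_base_e[OF refl assms])
qed

text \<open>A cell of the larger family is contained in the corresponding cell of the smaller one,
  so it carries more information. The comparison is made in the weighted sum: on a null cell
  \<open>ln 0 = 0\<close> breaks the inequality of logarithms, but the weight vanishes.\<close>

lemma ent_mono:
  assumes "finite_events M D" "C \<subseteq> D"
  shows "ent M C \<le> ent M D"
proof -
  have C: "finite_events M C" using assms by (auto intro: finite_subset)
  have sf: "simple_function M (\<lambda>x. (cell M C x, cell M D x))"
    by (intro simple_function_Pair simple_function_cell assms C)
  have "(\<Sum>w\<in>(\<lambda>x. (cell M C x, cell M D x)) ` space M. prob ((\<lambda>x. (cell M C x, cell M D x)) -` {w} \<inter> space M) * (ln (prob (snd w))))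
    \<le> (\<Sum>w\<in>(\<lambda>x. (cell M C x, cell M D x)) ` space M. prob ((\<lambda>x. (cell M C x, cell M D x)) -` {w} \<inter> space M) * (ln (prob (fst w))))"
  proof (intro sum_mono)
    fix w assume "w \<in> (\<lambda>x. (cell M C x, cell M D x)) ` space M"
    then obtain x where x: "x \<in> space M" "w = (cell M C x, cell M D x)" by auto
    have "(\<lambda>x. (cell M C x, cell M D x)) -` {w} \<inter> space M = cell M D x"
      using x assms(2) by (intro set_eqI) (simp add: mem_cell_iff, meson cell_eq_iff subsetD)
    moreover have "prob (cell M D x) \<le> prob (cell M C x)"
      using assms C by (intro finite_measure_mono cell_sets) (auto simp: cell_def)
    ultimately show "prob ((\<lambda>x. (cell M C x, cell M D x)) -` {w} \<inter> space M) * ln (prob (snd w))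
      \<le> prob ((\<lambda>x. (cell M C x, cell M D x)) -` {w} \<inter> space M) * ln (prob (fst w))"
      using x measure_nonneg[of M "cell M D x"]
      by (cases "prob (cell M D x) = 0") (auto intro!: mult_left_mono ln_mono simp: less_le)
  qed
  then show ?thesis
    using assms C by (simp add: sum_prob_vimage[OF sf] ent_eq_integral)
qed

lemma cond_ent_nonneg: "finite_events M C \<Longrightarrow> finite_events M D \<Longrightarrow> 0 \<le> cond_ent M C D"
  unfolding cond_ent_def using ent_mono[of "C \<union> D" D] by simp

lemma cond_ent_chain: "cond_ent M (C \<union> C') D = cond_ent M C D + cond_ent M C' (C \<union> D)"
  by (simp add: cond_ent_def Un_ac)

lemma cond_ent_mono_left:
  "finite_events M C' \<Longrightarrow> finite_events M D \<Longrightarrow> C \<subseteq> C' \<Longrightarrow> cond_ent M C D \<le> cond_ent M C' D"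
  unfolding cond_ent_def using ent_mono[of "C' \<union> D" "C \<union> D"] by auto

text \<open>Submodularity in the case \<open>D \<subseteq> E\<close>, where every join with
  \<open>E\<close> absorbs \<open>D\<close>.\<close>

lemma cond_ent_antimono:
  assumes "finite_events M C" "finite_events M E" "D \<subseteq> E"
  shows "cond_ent M C E \<le> cond_ent M C D"
proof -
  have "finite_events M D" using assms by (auto intro: finite_subset)
  moreover have "C \<union> E \<union> D = C \<union> E" "E \<union> D = E" using assms(3) by auto
  ultimately show ?thesis
    using ent_submodular[OF assms(1) _ assms(2), of D] by (simp add: cond_ent_def)
qed

lemma cond_ent_subadd:
  assumes "finite_events M C" "finite_events M C'" "finite_events M D"
  shows "cond_ent M (C \<union> C') D \<le> cond_ent M C D + cond_ent M C' D"
  unfolding cond_ent_chain using cond_ent_antimono[of C' "C \<union> D" D] assms by simp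

lemma cond_ent_UN_le:
  assumes "finite F" "\<And>g. g \<in> F \<Longrightarrow> finite_events M (C g)" "finite_events M D"
  shows "cond_ent M (\<Union>g\<in>F. C g) D \<le> (\<Sum>g\<in>F. cond_ent M (C g) D)"
  using assms
proof (induction F)
  case empty
  then show ?case by (simp add: cond_ent_def)
next
  case (insert g F)
  then have "cond_ent M (C g \<union> (\<Union>g\<in>F. C g)) D \<le> cond_ent M (C g) D + cond_ent M (\<Union>g\<in>F. C g) D"
    by (intro cond_ent_subadd) auto
  with insert show ?case by (simp add: UN_insert)
qed

lemma cond_ent_le_ent: "finite_events M C \<Longrightarrow> finite_events M D \<Longrightarrow> cond_ent M C D \<le> ent M C"
  using cond_ent_antimono[of C D "{}"] by (simp add: cond_ent_def ent_empty)

text \<open>Adding \<open>E\<close> to the condition costs at most the entropy of \<open>E\<close>: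
  expand the entropy of \<open>C \<union> E\<close> given \<open>D\<close> in both orders and drop
  the nonnegative term with condition \<open>C \<union> D\<close>.\<close>

lemma cond_ent_Un_ge:
  assumes "finite_events M C" "finite_events M D" "finite_events M E"
  shows "cond_ent M C D - cond_ent M E D \<le> cond_ent M C (E \<union> D)"
  using cond_ent_chain[of E C D] cond_ent_chain[of C E D] cond_ent_nonneg[of E "C \<union> D"] assms
  by (simp add: Un_commute)

end

section \<open>Approximation by conditional entropy\<close>

lemma ent_cong: "(\<And>x. x \<in> space M \<Longrightarrow> cell M C x = cell M D x) \<Longrightarrow> ent M C = ent M D"
  unfolding ent_def by (metis image_cong)

lemma agree_sigma_sets:
  assumes "A \<in> sigma_sets (space M) C" "y \<in> cell M C x" "x \<in> space M"
  shows "x \<in> A \<longleftrightarrow> y \<in> A"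
  using assms by (induction rule: sigma_sets.induct) (auto simp: cell_def)

text \<open>An event generated by \<open>C\<close> is a union of cells of \<open>C\<close>, so it
  splits none of them.\<close>

lemma ent_insert_sigma_sets:
  assumes "A \<in> sigma_sets (space M) C"
  shows "ent M (insert A C) = ent M C"
proof (rule ent_cong, rule set_eqI)
  fix x y assume "x \<in> space M"
  then show "y \<in> cell M (insert A C) x \<longleftrightarrow> y \<in> cell M C x"
    using agree_sigma_sets[OF assms, of y x] by (auto simp: cell_def)
qed

lemma ent_with_complement:
  assumes "A \<in> D"
  shows "ent M (insert (space M - A) D) = ent M D"
proof (rule ent_cong, rule set_eqI)
  fix x y assume "x \<in> space M"
  then show "y \<in> cell M (insert (space M - A) D) x \<longleftrightarrow> y \<in> cell M D x"
    using assms by (auto simp: cell_def)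
qed

lemma cond_ent_with_complement: "cond_ent M {A, space M - A} D = cond_ent M {A} D"
  using ent_with_complement[of A "insert A D" M] by (simp add: cond_ent_def insert_commute)

text \<open>For \<open>a\<close> and \<open>b\<close> the measures of the two pieces into which an
  event cuts a cell, the right side is the contribution of that cell to the conditional entropy. If
  \<open>a \<le> b\<close>, then \<open>2 * a \<le> a + b\<close> bounds the logarithm of
  \<open>a\<close>, and monotonicity that of \<open>b\<close>.\<close>

lemma binary_entropy_ge_min:
  fixes a b :: real
  assumes "0 \<le> a" "0 \<le> b"
  shows "ln 2 * min a b \<le> (a + b) * ln (a + b) - a * ln a - b * ln b"
proof -
  have *: "ln 2 * a \<le> (a + b) * ln (a + b) - a * ln a - b * ln b"
    if "0 \<le> a" "a \<le> b" for a b :: real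
  proof (cases "a = 0")
    case False
    with that have "0 < a" by simp
    with that have "ln (2 * a) \<le> ln (a + b)" by (intro ln_mono) auto
    with \<open>0 < a\<close> that have "ln 2 + ln a \<le> ln (a + b)" "ln b \<le> ln (a + b)"
      by (simp_all add: ln_mult)
    with that have "a * (ln 2 + ln a) \<le> a * ln (a + b)" "b * ln b \<le> b * ln (a + b)"
      by (auto intro!: mult_left_mono)
    then show ?thesis by (simp add: algebra_simps)
  qed auto
  show ?thesis
    using *[of a b] *[of b a] assms by (cases "a \<le> b") (auto simp: add.commute)
qed

section \<open>Small conditional entropy as closeness in measure\<close>

context prob_space
begin

lemma ent_singleton:
  assumes "A \<in> sets M"
  shows "ent M {A} = - (prob A * ln (prob A)) - (1 - prob A) * ln (1 - prob A)"
proof -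
  \<comment> \<open>A trivial event has a single cell, so the empty set must be taken out; it
    returns to the sum below with the term \<open>0 * ln 0 = 0\<close>.\<close>
  have "cell M {A} ` space M = {A, space M - A} - {{}}"
  proof (intro equalityI subsetI)
    fix s assume "s \<in> cell M {A} ` space M"
    then obtain x where "x \<in> space M" "s = cell M {A} x" by auto
    then show "s \<in> {A, space M - A} - {{}}"
      using sets.sets_into_space[OF assms] by (cases "x \<in> A") (auto simp: cell_def)
  next
    fix s assume "s \<in> {A, space M - A} - {{}}"
    then obtain x where "x \<in> s" "s = A \<or> s = space M - A" by auto
    then have "x \<in> space M" "s = cell M {A} x"
      using sets.sets_into_space[OF assms] by (auto simp: cell_def)
    then show "s \<in> cell M {A} ` space M" by auto
  qed
  \<comment> \<open>Otherwise the sum over the set \<open>{A, space M - A}\<close> would have one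
    term instead of two.\<close>
  moreover have "A \<noteq> space M - A"
    using not_empty sets.sets_into_space[OF assms] by auto
  moreover have "(\<Sum>s\<in>{A, space M - A} - {{}}. prob s * ln (prob s))
      = (\<Sum>s\<in>{A, space M - A}. prob s * ln (prob s))"
    by (intro sum.mono_neutral_left) auto
  ultimately show ?thesis
    by (simp add: ent_def partition_entropy_def prob_compl[OF assms])
qed

lemma ent_singleton_small:
  fixes e :: real
  assumes "0 < e"
  obtains d where "0 < d" "\<And>A. A \<in> sets M \<Longrightarrow> prob A < d \<Longrightarrow> ent M {A} < e"
proof -
  let ?h = "\<lambda>p::real. - (p * ln p) - (1 - p) * ln (1 - p)"
  have "(?h \<longlongrightarrow> 0) (at_right 0)" by real_asymp
  then have "eventually (\<lambda>p. ?h p < e) (at_right 0)"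
    using assms by (rule order_tendstoD)
  then obtain d where d: "0 < d" "\<And>p. 0 < p \<Longrightarrow> p < d \<Longrightarrow> ?h p < e"
    unfolding eventually_at_right_field by auto
  have "ent M {A} < e" if "A \<in> sets M" "prob A < d" for A
  proof (cases "prob A = 0")
    case False
    then show ?thesis
      using d(2)[of "prob A"] that by (simp add: ent_singleton less_le)
  qed (simp add: ent_singleton that assms)
  with d(1) show thesis by (rule that)
qed

text \<open>Given \<open>C\<close>, the event \<open>B\<close> is known, and then \<open>A\<close>
  and the symmetric difference determine each other.\<close>

lemma cond_ent_le_ent_sym_diff:
  assumes A: "A \<in> sets M" and C: "finite_events M C" and B: "B \<in> sigma_sets (space M) C"
  shows "cond_ent M {A} C \<le> ent M {sym_diff A B}"
proof -
  have Bs: "B \<in> sets M" using B C sets.sigma_sets_subset[of C M] by auto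
  let ?E = "sym_diff A B"
  have E: "?E \<in> sets M" using A Bs by auto
  have "cond_ent M {A} C \<le> cond_ent M {A, B, ?E} C"
    using A Bs E C by (intro cond_ent_mono_left) auto
  also have "\<dots> = cond_ent M {?E} C"
  proof -
    have "A = sym_diff ?E B" by auto
    moreover have "sym_diff ?E B \<in> sigma_sets (space M) (insert ?E C)"
    proof -
      interpret sigma_algebra "space M" "sigma_sets (space M) (insert ?E C)"
        using C E by (intro sigma_algebra_sigma_sets) (auto dest: sets.sets_into_space)
      have "?E \<in> sigma_sets (space M) (insert ?E C)" by (rule sigma_sets.Basic) simp
      moreover have "B \<in> sigma_sets (space M) (insert ?E C)"
        using B by (rule sigma_sets_mono'[THEN subsetD, rotated]) auto
      ultimately show ?thesis by blast
    qed
    ultimately have A': "A \<in> sigma_sets (space M) (insert ?E C)" by simp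
    have "ent M (insert A (insert B (insert ?E C))) = ent M (insert B (insert ?E C))"
      by (intro ent_insert_sigma_sets sigma_sets_mono'[THEN subsetD, OF _ A']) auto
    also have "\<dots> = ent M (insert ?E C)"
      by (intro ent_insert_sigma_sets sigma_sets_mono'[THEN subsetD, OF _ B]) auto
    finally show ?thesis by (simp add: cond_ent_def)
  qed
  also have "\<dots> \<le> ent M {?E}"
    using E C by (intro cond_ent_le_ent) auto
  finally show ?thesis .
qed

text \<open>A quantitative converse of the preceding bound. \<open>B\<close> is found by majority
  vote in each cell, and the error there, the smaller of the two pieces, is controlled by
  \<open>binary_entropy_ge_min\<close>.\<close>

lemma cond_ent_ge_sym_diff:
  assumes A: "A \<in> sets M" and C: "finite_events M C"
  obtains B where "B \<in> sigma_sets (space M) C" "ln 2 * prob (sym_diff A B) \<le> cond_ent M {A} C"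
proof -
  let ?S = "cell M C ` space M"
  have fin: "finite ?S" and S: "\<And>s. s \<in> ?S \<Longrightarrow> s \<in> sets M"
    using C by (auto intro: finite_cells cell_sets)
  have Asp: "A \<subseteq> space M" using A by (rule sets.sets_into_space)
  define W where "W x = (cell M C x, x \<in> A)" for x
  have sA: "simple_function M (\<lambda>x. x \<in> A)"
    unfolding simple_function_def
  proof (intro conjI ballI)
    fix t assume "t \<in> (\<lambda>x. x \<in> A) ` space M"
    have "(\<lambda>x. x \<in> A) -` {t} \<inter> space M = (if t then A else space M - A)"
      using Asp by auto
    then show "(\<lambda>x. x \<in> A) -` {t} \<inter> space M \<in> sets M" using A by simp
  qed auto
  have sW: "simple_function M W"
    unfolding W_def by (intro simple_function_Pair sA simple_function_cell C)
  let ?p = "\<lambda>w. prob (W -` {w} \<inter> space M)"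
  have vim: "W -` {(s, t)} \<inter> space M = (if t then s \<inter> A else s - A)" if s: "s \<in> ?S" for s t
  proof -
    obtain x where x: "x \<in> space M" "s = cell M C x" using s by auto
    show ?thesis
      unfolding x(2) by (intro set_eqI) (auto simp: W_def mem_cell_iff[OF x(1)])
  qed
  have "- ent M (insert A C) = (\<integral>x. ln (prob (cell M (insert A C) x)) \<partial>M)"
    using A C by (simp add: ent_eq_integral)
  also have "\<dots> = (\<integral>x. ln (?p (W x)) \<partial>M)"
  proof (intro Bochner_Integration.integral_cong refl arg_cong[where f="\<lambda>s. ln (prob s)"])
    fix x assume x: "x \<in> space M"
    show "cell M (insert A C) x = W -` {W x} \<inter> space M"
      unfolding W_def[of x] using x by (subst vim) (auto simp: cell_def)
  qed
  also have "\<dots> = (\<Sum>w\<in>W ` space M. ?p w * ln (?p w))"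
    using sum_prob_vimage[OF sW, of "\<lambda>w. ln (?p w)"] by simp
  \<comment> \<open>Summing over all pairs adds only values that are not attained, whose terms
    vanish, and makes the sum split cell by cell.\<close>
  also have "\<dots> = (\<Sum>w\<in>?S \<times> UNIV. ?p w * ln (?p w))"
  proof (intro sum.mono_neutral_left ballI)
    fix w assume "w \<in> ?S \<times> UNIV - W ` space M"
    then have "w \<notin> W ` space M" by simp
    then have "W -` {w} \<inter> space M = {}" by blast
    then show "?p w * ln (?p w) = 0" by simp
  qed (use fin in \<open>auto simp: W_def\<close>)
  also have "\<dots> = (\<Sum>s\<in>?S. \<Sum>t\<in>UNIV. ?p (s, t) * ln (?p (s, t)))"
    by (simp add: sum.cartesian_product)
  also have "\<dots> = (\<Sum>s\<in>?S. prob (s \<inter> A) * ln (prob (s \<inter> A)) + prob (s - A) * ln (prob (s - A)))"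
    by (intro sum.cong refl) (simp add: UNIV_bool vim add.commute)
  finally have eA: "ent M (insert A C)
      = - (\<Sum>s\<in>?S. prob (s \<inter> A) * ln (prob (s \<inter> A)) + prob (s - A) * ln (prob (s - A)))"
    by simp
  have split: "prob s = prob (s \<inter> A) + prob (s - A)" if "s \<in> ?S" for s
    using finite_measure_Union[of "s \<inter> A" "s - A"] S[OF that] A by (auto simp: Un_Diff_Int Un_commute)
  \<comment> \<open>The cells of which \<open>A\<close> fills more than half; \<open>?D s\<close> is
    the part of \<open>s\<close> on which \<open>A\<close> and \<open>B\<close> then
    disagree.\<close>
  define B where "B = \<Union>{s \<in> ?S. prob (s - A) < prob (s \<inter> A)}"
  let ?D = "\<lambda>s. if prob (s - A) < prob (s \<inter> A) then s - A else s \<inter> A"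
  have "B \<in> sigma_sets (space M) C"
  proof -
    interpret sigma_algebra "space M" "sigma_sets (space M) C"
      using C by (intro sigma_algebra_sigma_sets) (auto dest: sets.sets_into_space)
    show ?thesis
      unfolding B_def using fin C
      by (intro finite_Union) (auto intro!: cell_sigma_sets dest: sets.sets_into_space)
  qed
  moreover have "ln 2 * prob (sym_diff A B) \<le> cond_ent M {A} C"
  proof -
    have "sym_diff A B \<subseteq> (\<Union>s\<in>?S. ?D s)"
    proof
      fix x assume x: "x \<in> sym_diff A B"
      then have xs: "x \<in> space M" using Asp by (auto simp: B_def cell_def)
      let ?s = "cell M C x"
      have "x \<in> ?s" by (rule mem_cell_self[OF xs])
      have "x \<in> B \<longleftrightarrow> prob (?s - A) < prob (?s \<inter> A)"
      proof
        assume "x \<in> B"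
        then obtain y where y: "y \<in> space M" "x \<in> cell M C y"
          "prob (cell M C y - A) < prob (cell M C y \<inter> A)" by (auto simp: B_def)
        then show "prob (?s - A) < prob (?s \<inter> A)" by (simp add: mem_cell_iff)
      qed (use xs \<open>x \<in> ?s\<close> in \<open>auto simp: B_def\<close>)
      with x \<open>x \<in> ?s\<close> have "x \<in> ?D ?s" by auto
      with xs show "x \<in> (\<Union>s\<in>?S. ?D s)" by blast
    qed
    then have "prob (sym_diff A B) \<le> prob (\<Union>s\<in>?S. ?D s)"
      using S A fin by (intro finite_measure_mono sets.finite_UN) auto
    also have "\<dots> \<le> (\<Sum>s\<in>?S. prob (?D s))"
      using S A fin by (intro finite_measure_subadditive_finite) auto
    also have "\<dots> = (\<Sum>s\<in>?S. min (prob (s \<inter> A)) (prob (s - A)))"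
      by (intro sum.cong) auto
    finally have "ln 2 * prob (sym_diff A B) \<le> (\<Sum>s\<in>?S. ln 2 * min (prob (s \<inter> A)) (prob (s - A)))"
      by (simp add: sum_distrib_left[symmetric])
    also have "\<dots> \<le> (\<Sum>s\<in>?S. prob s * ln (prob s)
        - prob (s \<inter> A) * ln (prob (s \<inter> A)) - prob (s - A) * ln (prob (s - A)))"
    proof (intro sum_mono)
      fix s assume "s \<in> ?S"
      then show "ln 2 * min (prob (s \<inter> A)) (prob (s - A)) \<le> prob s * ln (prob s)
        - prob (s \<inter> A) * ln (prob (s \<inter> A)) - prob (s - A) * ln (prob (s - A))"
        using binary_entropy_ge_min[of "prob (s \<inter> A)" "prob (s - A)"] by (simp flip: split)
    qed
    also have "\<dots> = cond_ent M {A} C"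
      by (simp add: cond_ent_def eA) (simp add: ent_def partition_entropy_def sum_subtractf sum.distrib)
    finally show ?thesis .
  qed
  ultimately show thesis by (rule that)
qed

text \<open>The events that are approximable from finite subfamilies of \<open>G\<close> form a
  sigma-algebra. For a countable union, half of the error is spent on cutting it to finitely many
  sets and half on approximating those.\<close>

lemma sigma_sets_approx:
  fixes e :: real
  assumes G: "G \<subseteq> sets M" and "A \<in> sigma_sets (space M) G" and "0 < e"
  shows "\<exists>C B. finite C \<and> C \<subseteq> G \<and> B \<in> sigma_sets (space M) C \<and> prob (sym_diff A B) < e"
  using assms(2,3)
proof (induction arbitrary: e rule: sigma_sets.induct)
  case (Basic a)
  then show ?case
    by (intro exI[of _ "{a}"] exI[of _ a]) (auto intro: sigma_sets.Basic)
next
  case Empty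
  then show ?case
    by (intro exI[of _ "{}"]) (auto intro: sigma_sets.Empty)
next
  case (Compl a)
  then obtain C B where CB: "finite C" "C \<subseteq> G" "B \<in> sigma_sets (space M) C" "prob (sym_diff a B) < e"
    by blast
  have "a \<subseteq> space M" "B \<subseteq> space M"
    using Compl(1) CB(2,3) G sets.sigma_sets_subset[of G M] sets.sigma_sets_subset[of C M]
    by (meson sets.sets_into_space subset_eq subset_trans)+
  then have "sym_diff (space M - a) (space M - B) = sym_diff a B" by auto
  with CB show ?case
    by (intro exI[of _ C] exI[of _ "space M - B"]) (auto intro: sigma_sets.Compl)
next
  case (Union a)
  have a: "a i \<in> sets M" for i
    using Union(1)[of i] G sets.sigma_sets_subset[of G M] by auto
  have "(\<lambda>n. prob (\<Union>i\<in>{..<n}. a i)) \<longlonglongrightarrow> prob (\<Union>n. \<Union>i\<in>{..<n}. a i)"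
  proof (intro finite_Lim_measure_incseq)
    show "incseq (\<lambda>n. \<Union>i\<in>{..<n}. a i)"
      unfolding incseq_def by (intro allI impI UN_mono) auto
  qed (use a in auto)
  moreover have "(\<Union>n. \<Union>i\<in>{..<n}. a i) = (\<Union>i. a i)" by auto
  ultimately have "(\<lambda>n. prob (\<Union>i\<in>{..<n}. a i)) \<longlonglongrightarrow> prob (\<Union>i. a i)" by simp
  then have "eventually (\<lambda>n. prob (\<Union>i. a i) - e / 2 < prob (\<Union>i\<in>{..<n}. a i)) sequentially"
    by (rule order_tendstoD) (use Union.prems in simp)
  then obtain n where n: "prob (\<Union>i. a i) - e / 2 < prob (\<Union>i\<in>{..<n}. a i)"
    by (auto simp: eventually_sequentially)
  \<comment> \<open>The summand 1 in the denominator keeps the error positive when the truncated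
    union is empty; the \<open>n\<close> errors still add up to at most
    \<open>e / 2\<close>.\<close>
  have "\<exists>C B. finite C \<and> C \<subseteq> G \<and> B \<in> sigma_sets (space M) C \<and> prob (sym_diff (a i) B) < e / (2 * (real n + 1))" for i
    using Union.prems by (intro Union.IH) auto
  then obtain C B where CB: "\<And>i. finite (C i)" "\<And>i. C i \<subseteq> G" "\<And>i. B i \<in> sigma_sets (space M) (C i)"
    "\<And>i. prob (sym_diff (a i) (B i)) < e / (2 * (real n + 1))"
    by metis
  let ?C = "\<Union>i\<in>{..<n}. C i" and ?B = "\<Union>i\<in>{..<n}. B i"
  have Bs: "B i \<in> sets M" for i
    using CB(2,3)[of i] G sets.sigma_sets_subset[of "C i" M] by auto
  have CG: "?C \<subseteq> G" using CB(2) by auto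
  have "?B \<in> sigma_sets (space M) ?C"
  proof -
    interpret sigma_algebra "space M" "sigma_sets (space M) ?C"
      using CG G by (intro sigma_algebra_sigma_sets) (auto dest: sets.sets_into_space)
    show ?thesis
      by (intro finite_UN) (auto intro: sigma_sets_mono'[THEN subsetD, OF _ CB(3)])
  qed
  moreover have "prob (sym_diff (\<Union>i. a i) ?B) < e"
  proof -
    let ?a = "\<Union>i\<in>{..<n}. a i"
    have "prob (sym_diff (\<Union>i. a i) ?B) \<le> prob (((\<Union>i. a i) - ?a) \<union> (\<Union>i\<in>{..<n}. sym_diff (a i) (B i)))"
      using a Bs by (intro finite_measure_mono sets.Un sets.Diff sets.finite_UN sets.countable_UN) auto
    also have "\<dots> \<le> prob ((\<Union>i. a i) - ?a) + prob (\<Union>i\<in>{..<n}. sym_diff (a i) (B i))"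
      using a Bs by (intro measure_Un_le sets.Un sets.Diff sets.finite_UN sets.countable_UN) auto
    also have "prob ((\<Union>i. a i) - ?a) = prob (\<Union>i. a i) - prob ?a"
      using a by (intro finite_measure_Diff) auto
    also have "prob (\<Union>i\<in>{..<n}. sym_diff (a i) (B i)) \<le> (\<Sum>i\<in>{..<n}. prob (sym_diff (a i) (B i)))"
      using a Bs by (intro finite_measure_subadditive_finite) auto
    also have "\<dots> \<le> (\<Sum>i\<in>{..<n}. e / (2 * (real n + 1)))"
      using CB(4) by (intro sum_mono less_imp_le)
    also have "\<dots> \<le> e / 2"
      using Union.prems by (simp add: field_simps)
    finally show ?thesis using n by simp
  qed
  ultimately show ?case
    using CB(1) CG by (intro exI[of _ ?C] exI[of _ ?B]) auto
qed

text \<open>Choose approximants with errors below \<open>(1/2)^k\<close>. By Borel-Cantelli almost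
  every point lies in only finitely many of the error sets, so the limit superior \<open>?L\<close>
  of the approximants agrees with \<open>A\<close> almost everywhere.\<close>

lemma sigma_sets_ae_limit:
  assumes G: "G \<subseteq> sets M" and A: "A \<in> sets M"
    and approx: "\<And>e::real. 0 < e \<Longrightarrow> \<exists>B\<in>sigma_sets (space M) G. prob (sym_diff A B) < e"
  shows "\<exists>B\<in>sigma_sets (space M) G. prob (sym_diff A B) = 0"
proof -
  have "\<exists>B\<in>sigma_sets (space M) G. prob (sym_diff A B) < (1/2)^k" for k :: nat
    by (rule approx) simp
  then obtain B where B: "\<And>k. B k \<in> sigma_sets (space M) G" "\<And>k::nat. prob (sym_diff A (B k)) < (1/2)^k"
    by (metis (no_types, lifting))
  have Bs: "B k \<in> sets M" for k
    using B(1)[of k] G sets.sigma_sets_subset[of G M] by auto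
  interpret sa: sigma_algebra "space M" "sigma_sets (space M) G"
    using G by (intro sigma_algebra_sigma_sets) (auto dest: sets.sets_into_space)
  let ?L = "\<Inter>n. \<Union>k\<in>{n..}. B k"
  have null: "limsup (\<lambda>k. sym_diff A (B k)) \<in> null_sets M"
  proof (rule borel_cantelli_limsup1)
    show "summable (\<lambda>k. prob (sym_diff A (B k)))"
      by (rule summable_comparison_test'[OF summable_geometric[of "1/2::real"], of 0])
         (simp_all add: less_imp_le[OF B(2)])
    show "sym_diff A (B k) \<in> sets M" for k
      using A Bs by (intro sets.Un sets.Diff)
    show "emeasure M (sym_diff A (B k)) < \<infinity>" for k
      unfolding emeasure_eq_measure by simp
  qed
  have sub: "sym_diff A ?L \<subseteq> limsup (\<lambda>k. sym_diff A (B k))"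
  proof
    fix x assume "x \<in> sym_diff A ?L"
    then show "x \<in> limsup (\<lambda>k. sym_diff A (B k))"
    proof
      assume "x \<in> A - ?L"
      then obtain n where n: "x \<in> A" "\<And>k. n \<le> k \<Longrightarrow> x \<notin> B k" by auto
      have "\<exists>k\<ge>m. x \<in> sym_diff A (B k)" for m
        using n by (intro exI[of _ "max m n"]) auto
      then show ?thesis unfolding limsup_INF_SUP by blast
    next
      assume "x \<in> ?L - A"
      then show ?thesis unfolding limsup_INF_SUP by blast
    qed
  qed
  have L: "?L \<in> sigma_sets (space M) G"
  proof (intro sa.countable_INT)
    have "(\<Union>k\<in>{n..}. B k) \<in> sigma_sets (space M) G" for n
      using B(1) by (intro sa.countable_UN'') simp_all
    then show "range (\<lambda>n. \<Union>k\<in>{n..}. B k) \<subseteq> sigma_sets (space M) G" by auto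
  qed simp
  have "?L \<in> sets M"
    using L sets.sigma_sets_subset[OF G] by (rule subsetD[rotated])
  then have "sym_diff A ?L \<in> sets M" using A by (intro sets.Un sets.Diff)
  then have "sym_diff A ?L \<in> null_sets M"
    by (rule null_sets_subset[OF null _ sub])
  then have "prob (sym_diff A ?L) = 0" by (rule measure_eq_0_null_sets)
  with L show ?thesis by (rule bexI[rotated])
qed

end

section \<open>Measure-preserving actions\<close>

text \<open>The generators of the sigma-algebra \<open>C\<^sup>D\<close>. For finite
  \<open>D\<close> the cells of this family are the atoms of the join of the translates; for
  infinite \<open>D\<close> the family still makes sense.\<close>

definition translates ::
    "'x measure \<Rightarrow> ('g \<Rightarrow> 'x \<Rightarrow> 'x) \<Rightarrow> 'x set set \<Rightarrow> 'g set \<Rightarrow> 'x set set" where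
  "translates M T C D = (\<Union>g\<in>D. pullback M T C g)"

locale measure_preserving = prob_space M for M :: "'x measure" +
  fixes T :: "'g::{group_add, countable} \<Rightarrow> 'x \<Rightarrow> 'x"
  assumes pmp: "pmp_action M T"
begin

abbreviation pb :: "'x set set \<Rightarrow> 'g \<Rightarrow> 'x set set" where
  "pb \<equiv> pullback M T"

abbreviation tr :: "'x set set \<Rightarrow> 'g set \<Rightarrow> 'x set set" where
  "tr \<equiv> translates M T"

lemma measurable_T: "T g \<in> M \<rightarrow>\<^sub>M M"
  and distr_T: "distr M M (T g) = M"
  and T_zero: "x \<in> space M \<Longrightarrow> T 0 x = x"
  and T_add: "x \<in> space M \<Longrightarrow> T (g + h) x = T g (T h x)"
  using pmp by (auto simp: pmp_action_def)

lemma T_space: "x \<in> space M \<Longrightarrow> T g x \<in> space M"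
  using measurable_space[OF measurable_T] .

lemma pb_Un: "pb (C \<union> D) g = pb C g \<union> pb D g"
  by (auto simp: pullback_def)

lemma pb_events: "finite_events M C \<Longrightarrow> finite_events M (pb C g)"
  using measurable_sets[OF measurable_T] by (auto simp: pullback_def)

lemma pb_0: "C \<subseteq> sets M \<Longrightarrow> pb C 0 = C"
proof -
  assume C: "C \<subseteq> sets M"
  have "T 0 -` A \<inter> space M = A" if "A \<in> C" for A
  proof -
    have "A \<subseteq> space M" using that C by (intro sets.sets_into_space) auto
    then show ?thesis using T_zero by (auto simp: subset_iff)
  qed
  then show ?thesis by (auto simp: pullback_def)
qed

lemma pb_pb: "pb (pb C g) h = pb C (g + h)"
proof -
  have "T h -` (T g -` A \<inter> space M) \<inter> space M = T (g + h) -` A \<inter> space M" for A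
    by (auto simp: T_add T_space)
  then show ?thesis by (simp add: pullback_def image_image)
qed

lemma tr_empty [simp]: "tr C {} = {}"
  by (simp add: translates_def)

lemma tr_insert: "tr C (insert g D) = pb C g \<union> tr C D"
  by (simp add: translates_def)

lemma tr_Un_left: "tr (C \<union> C') D = tr C D \<union> tr C' D"
  by (auto simp: translates_def pb_Un)

lemma tr_Un: "tr C (D \<union> E) = tr C D \<union> tr C E"
  by (auto simp: translates_def)

lemma tr_mono: "C \<subseteq> C' \<Longrightarrow> D \<subseteq> E \<Longrightarrow> tr C D \<subseteq> tr C' E"
  unfolding translates_def pullback_def by blast

lemma tr_sets: "C \<subseteq> sets M \<Longrightarrow> tr C D \<subseteq> sets M"
  using measurable_sets[OF measurable_T] by (auto simp: translates_def pullback_def)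

lemma tr_events: "finite_events M C \<Longrightarrow> finite D \<Longrightarrow> finite_events M (tr C D)"
  using tr_sets[of C D] by (auto simp: translates_def pullback_def)

lemma pb_subset_tr: "g \<in> D \<Longrightarrow> pb C g \<subseteq> tr C D"
  by (auto simp: translates_def)

text \<open>As \<open>T (h + g)\<close> is \<open>T h\<close> after \<open>T g\<close>, pulling back
  by \<open>g\<close> multiplies the index set by \<open>g\<close> on the right, which is also the
  side on which \<open>G\<close> acts on orders.\<close>

lemma pb_tr: "pb (tr C D) g = tr C ((\<lambda>h. h + g) ` D)"
proof -
  have "pb (tr C D) g = (\<Union>h\<in>D. pb (pb C h) g)"
    by (simp add: translates_def pullback_def image_UN)
  then show ?thesis by (simp add: pb_pb translates_def)
qed

text \<open>Since \<open>T g\<close> maps the space onto itself, by the inverse element, taking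
  preimages under it is injective on cells, and it preserves their measures.\<close>

lemma ent_pb:
  assumes C: "finite_events M C"
  shows "ent M (pb C g) = ent M C"
proof -
  let ?f = "\<lambda>s. T g -` s \<inter> space M" and ?S = "cell M C ` space M"
  have surj: "\<exists>y\<in>space M. x = T g y" if "x \<in> space M" for x
    using T_add[OF that, of g "- g"] T_zero[OF that] T_space[OF that, of "- g"] by force
  have c: "cell M (pb C g) x = ?f (cell M C (T g x))" if "x \<in> space M" for x
    using that by (auto simp: cell_def pullback_def T_space)
  have "cell M (pb C g) ` space M = ?f ` cell M C ` T g ` space M"
    unfolding image_image by (intro image_cong refl c)
  also have "T g ` space M = space M"
    using surj by (auto simp: T_space)
  finally have cells: "cell M (pb C g) ` space M = ?f ` ?S" .
  have inj: "inj_on ?f ?S"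
  proof (rule inj_onI)
    fix s t assume st: "s \<in> ?S" "t \<in> ?S" and eq: "?f s = ?f t"
    have *: "s' \<subseteq> t'" if "s' \<in> ?S" "?f s' = ?f t'" for s' t'
    proof
      fix x assume "x \<in> s'"
      moreover have "x \<in> space M" using that(1) \<open>x \<in> s'\<close> by (auto simp: cell_def)
      ultimately obtain y where "y \<in> space M" "x = T g y" "y \<in> ?f s'"
        using surj by blast
      with that(2) show "x \<in> t'" by auto
    qed
    show "s = t" using *[OF st(1) eq] *[OF st(2) eq[symmetric]] by auto
  qed
  have prob_f: "prob (?f s) = prob s" if "s \<in> ?S" for s
  proof -
    have "s \<in> sets M" using that C by (auto intro: cell_sets)
    then have "measure (distr M M (T g)) s = prob (?f s)"
      by (intro measure_distr measurable_T)
    then show ?thesis by (simp add: distr_T)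
  qed
  show ?thesis
    unfolding ent_def partition_entropy_def cells by (simp add: sum.reindex[OF inj] prob_f)
qed

lemma cond_ent_pb:
  "finite_events M C \<Longrightarrow> finite_events M D \<Longrightarrow> cond_ent M (pb C g) (pb D g) = cond_ent M C D"
  by (simp add: cond_ent_def ent_pb flip: pb_Un)

text \<open>For infinite \<open>D\<close> this is the conditional entropy \<open>H(Q | C\<^sup>D)\<close>, by its continuity along the finite
  subsets of \<open>D\<close>.\<close>

definition cond_ent_on :: "'x set set \<Rightarrow> 'x set set \<Rightarrow> 'g set \<Rightarrow> real" where
  "cond_ent_on Q C D = (INF L\<in>{L. finite L \<and> L \<subseteq> D}. cond_ent M Q (tr C L))"

section \<open>Conditional entropy given infinitely many translates\<close>

lemma cond_ent_on_le:
  assumes "finite_events M Q" "finite_events M C" "finite L" "L \<subseteq> D"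
  shows "cond_ent_on Q C D \<le> cond_ent M Q (tr C L)"
  unfolding cond_ent_on_def
proof (rule cINF_lower)
  show "bdd_below ((\<lambda>L. cond_ent M Q (tr C L)) ` {L. finite L \<and> L \<subseteq> D})"
    by (rule bdd_belowI2[of _ 0]) (use assms in \<open>simp add: cond_ent_nonneg tr_events\<close>)
qed (use assms in auto)

lemma cond_ent_on_greatest:
  assumes "\<And>L. finite L \<Longrightarrow> L \<subseteq> D \<Longrightarrow> c \<le> cond_ent M Q (tr C L)"
  shows "c \<le> cond_ent_on Q C D"
  unfolding cond_ent_on_def by (rule cINF_greatest) (use assms in auto)

lemma cond_ent_on_approx:
  assumes "0 < e"
  obtains L where "finite L" "L \<subseteq> D" "cond_ent M Q (tr C L) < cond_ent_on Q C D + e"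
proof -
  have "\<not> cond_ent_on Q C D + e \<le> cond_ent_on Q C D" using assms by simp
  then show thesis using cond_ent_on_greatest[of D "cond_ent_on Q C D + e" Q C] that by fastforce
qed

lemma cond_ent_on_nonneg: "finite_events M Q \<Longrightarrow> finite_events M C \<Longrightarrow> 0 \<le> cond_ent_on Q C D"
  by (intro cond_ent_on_greatest cond_ent_nonneg tr_events)

lemma cond_ent_on_le_ent: "finite_events M Q \<Longrightarrow> finite_events M C \<Longrightarrow> cond_ent_on Q C D \<le> ent M Q"
  using cond_ent_on_le[of Q C "{}" D] by (simp add: cond_ent_def ent_empty)

lemma cond_ent_on_pb:
  assumes "finite_events M Q" "finite_events M C"
  shows "cond_ent_on (pb Q g) C ((\<lambda>h. h + g) ` D) = cond_ent_on Q C D"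
proof -
  have "{L. finite L \<and> L \<subseteq> (\<lambda>h. h + g) ` D} = (\<lambda>L. (\<lambda>h. h + g) ` L) ` {L. finite L \<and> L \<subseteq> D}"
    by (auto simp: image_iff) (metis finite_subset_image)
  then show ?thesis
    unfolding cond_ent_on_def using assms by (simp add: image_image cond_ent_pb tr_events flip: pb_tr)
qed

lemma cond_ent_on_antimono:
  assumes "finite_events M Q" "finite_events M C'" "C \<subseteq> C'"
  shows "cond_ent_on Q C' D \<le> cond_ent_on Q C D"
proof (rule cond_ent_on_greatest)
  fix L assume L: "finite L" "L \<subseteq> D"
  have "cond_ent_on Q C' D \<le> cond_ent M Q (tr C' L)" using assms L by (intro cond_ent_on_le)
  also have "\<dots> \<le> cond_ent M Q (tr C L)"
    using assms L by (intro cond_ent_antimono tr_events tr_mono) auto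
  finally show "cond_ent_on Q C' D \<le> cond_ent M Q (tr C L)" .
qed

text \<open>Nearly optimal finite sets for the two terms on the right are merged; a larger condition
  only lowers each term.\<close>

lemma cond_ent_on_subadd:
  assumes Q: "finite_events M Q" "finite_events M Q'" and C: "finite_events M C"
  shows "cond_ent_on (Q \<union> Q') C D \<le> cond_ent_on Q C D + cond_ent_on Q' C D"
proof (rule field_le_epsilon)
  fix e :: real assume "0 < e"
  then have "0 < e / 2" by simp
  obtain L where L: "finite L" "L \<subseteq> D" "cond_ent M Q (tr C L) < cond_ent_on Q C D + e / 2"
    using cond_ent_on_approx[OF \<open>0 < e / 2\<close>] .
  obtain L' where L': "finite L'" "L' \<subseteq> D" "cond_ent M Q' (tr C L') < cond_ent_on Q' C D + e / 2"
    using cond_ent_on_approx[OF \<open>0 < e / 2\<close>] .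
  have ev: "finite_events M (tr C (L \<union> L'))" using C L L' by (intro tr_events) auto
  have "cond_ent_on (Q \<union> Q') C D \<le> cond_ent M (Q \<union> Q') (tr C (L \<union> L'))"
    using Q C L L' by (intro cond_ent_on_le) auto
  also have "\<dots> \<le> cond_ent M Q (tr C (L \<union> L')) + cond_ent M Q' (tr C (L \<union> L'))"
    using Q by (intro cond_ent_subadd ev)
  also have "cond_ent M Q (tr C (L \<union> L')) \<le> cond_ent M Q (tr C L)"
    using Q by (intro cond_ent_antimono ev tr_mono) auto
  also have "cond_ent M Q' (tr C (L \<union> L')) \<le> cond_ent M Q' (tr C L')"
    using Q by (intro cond_ent_antimono ev tr_mono) auto
  finally show "cond_ent_on (Q \<union> Q') C D \<le> cond_ent_on Q C D + cond_ent_on Q' C D + e" using L L' by simp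
qed

text \<open>An increasing exhaustion of \<open>G\<close> by finite sets, taken from the enumeration
  \<open>to_nat\<close>. It is not assumed to be a Folner sequence.\<close>

definition window :: "nat \<Rightarrow> 'g set" where
  "window n = {g. to_nat g < n}"

lemma finite_window: "finite (window n)"
  unfolding window_def using finite_vimageI[of "{..<n}" "to_nat :: 'g \<Rightarrow> nat"]
  by (simp add: vimage_def)

lemma window_mono: "m \<le> n \<Longrightarrow> window m \<subseteq> window n"
  by (auto simp: window_def)

lemma finite_subset_window:
  assumes "finite L" obtains n where "L \<subseteq> window n"
proof
  show "L \<subseteq> window (Suc (Max (to_nat ` L)))"
    using assms by (auto simp: window_def less_Suc_eq_le)
qed

text \<open>Replaces the infimum by the limit of a sequence, as measurability in the order and
  dominated convergence require.\<close>

lemma cond_ent_on_tendsto: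
  assumes "finite_events M Q" "finite_events M C"
  shows "(\<lambda>n. cond_ent M Q (tr C (window n \<inter> D))) \<longlonglongrightarrow> cond_ent_on Q C D"
proof (rule order_tendstoI)
  fix y assume "y < cond_ent_on Q C D"
  moreover have "cond_ent_on Q C D \<le> cond_ent M Q (tr C (window n \<inter> D))" for n
    using assms by (intro cond_ent_on_le) (auto simp: finite_window)
  ultimately show "eventually (\<lambda>n. y < cond_ent M Q (tr C (window n \<inter> D))) sequentially"
    by (simp add: less_le_trans)
next
  fix y assume "cond_ent_on Q C D < y"
  then obtain L where L: "finite L" "L \<subseteq> D" "cond_ent M Q (tr C L) < y"
    using cond_ent_on_approx[of "y - cond_ent_on Q C D" D Q C] by auto
  obtain m where m: "L \<subseteq> window m" using finite_subset_window[OF L(1)] .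
  have "cond_ent M Q (tr C (window n \<inter> D)) < y" if "m \<le> n" for n
  proof -
    have "cond_ent M Q (tr C (window n \<inter> D)) \<le> cond_ent M Q (tr C L)"
      using assms L m window_mono[OF that]
      by (intro cond_ent_antimono tr_events tr_mono) (auto simp: finite_window)
    with L show ?thesis by simp
  qed
  then show "eventually (\<lambda>n. cond_ent M Q (tr C (window n \<inter> D)) < y) sequentially"
    by (auto simp: eventually_sequentially)
qed

section \<open>Membership in \<open>P\<^sup>D\<close> in terms of conditional entropy\<close>

lemma join_algebra_alt:
  "join_algebra M T P D =
    {A \<in> sets M. \<exists>B\<in>sigma_sets (space M) (tr P D). prob (sym_diff A B) = 0}"
  by (simp add: join_algebra_def translates_def)

lemma join_algebra_mono: "D \<subseteq> E \<Longrightarrow> join_algebra M T P D \<subseteq> join_algebra M T P E"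
  unfolding join_algebra_alt using sigma_sets_mono'[OF tr_mono[OF order_refl, of D E]] by blast

lemma tr_finite_subset:
  assumes "finite S" "S \<subseteq> tr C D"
  obtains K where "finite K" "K \<subseteq> D" "S \<subseteq> tr C K"
proof -
  have "\<forall>s\<in>S. \<exists>g\<in>D. s \<in> pb C g" using assms(2) by (auto simp: translates_def)
  then obtain f where "\<forall>s\<in>S. f s \<in> D \<and> s \<in> pb C (f s)" by metis
  then show thesis
    using assms(1) by (intro that[of "f ` S"]) (auto simp: translates_def)
qed

lemma join_algebra_sets_approx:
  fixes e :: real
  assumes P: "P \<subseteq> sets M" and A: "A \<in> join_algebra M T P D" and "0 < e"
  obtains K B where "finite K" "K \<subseteq> D" "B \<in> sigma_sets (space M) (tr P K)" "prob (sym_diff A B) < e"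
proof -
  from A obtain B where B: "A \<in> sets M" "B \<in> sigma_sets (space M) (tr P D)" "prob (sym_diff A B) = 0"
    by (auto simp: join_algebra_alt)
  obtain S B' where S: "finite S" "S \<subseteq> tr P D" "B' \<in> sigma_sets (space M) S" "prob (sym_diff B B') < e"
    using sigma_sets_approx[OF tr_sets[OF P] B(2) \<open>0 < e\<close>] by auto
  obtain K where K: "finite K" "K \<subseteq> D" "S \<subseteq> tr P K"
    using tr_finite_subset[OF S(1,2)] .
  have B'K: "B' \<in> sigma_sets (space M) (tr P K)"
    using S(3) sigma_sets_mono'[OF K(3)] by blast
  have s: "B \<in> sets M" "B' \<in> sets M"
    using B(2) B'K sets.sigma_sets_subset[OF tr_sets[OF P]] by blast+
  have "prob (sym_diff A B') \<le> prob (sym_diff A B \<union> sym_diff B B')"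
    using B(1) s by (intro finite_measure_mono) auto
  also have "\<dots> \<le> prob (sym_diff A B) + prob (sym_diff B B')"
    using B(1) s by (intro measure_Un_le) auto
  finally show thesis using that[OF K(1,2) B'K] B(3) S(4) by simp
qed

lemma join_algebraI_sets_approx:
  assumes P: "P \<subseteq> sets M" and A: "A \<in> sets M"
    and "\<And>e::real. 0 < e \<Longrightarrow> \<exists>B\<in>sigma_sets (space M) (tr P D). prob (sym_diff A B) < e"
  shows "A \<in> join_algebra M T P D"
  using sigma_sets_ae_limit[OF tr_sets[OF P] A assms(3)] A by (simp add: join_algebra_alt)

lemma join_algebra_closed:
  assumes P: "P \<subseteq> sets M" and A: "A \<in> sets M"
    and approx: "\<And>e::real. 0 < e \<Longrightarrow> \<exists>A'\<in>join_algebra M T P D. prob (sym_diff A A') < e"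
  shows "A \<in> join_algebra M T P D"
proof (rule join_algebraI_sets_approx[OF P A])
  fix e :: real assume "0 < e"
  then obtain A' B where A': "A' \<in> sets M" "B \<in> sigma_sets (space M) (tr P D)"
    "prob (sym_diff A' B) = 0" "prob (sym_diff A A') < e"
    using approx[of e] by (auto simp: join_algebra_alt)
  have s: "B \<in> sets M"
    using A'(2) sets.sigma_sets_subset[OF tr_sets[OF P]] by blast
  have "prob (sym_diff A B) \<le> prob (sym_diff A A' \<union> sym_diff A' B)"
    using A A' s by (intro finite_measure_mono) auto
  also have "\<dots> \<le> prob (sym_diff A A') + prob (sym_diff A' B)"
    using A A' s by (intro measure_Un_le) auto
  finally show "\<exists>B\<in>sigma_sets (space M) (tr P D). prob (sym_diff A B) < e"
    using A' by (intro bexI[of _ B]) auto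
qed

text \<open>An event close in measure to one generated by finitely many translates has small entropy
  given these, because the entropy of the symmetric difference is small. Together with
  \<open>join_algebraI_cond_ent\<close> this characterizes \<open>P\<^sup>D\<close> by
  entropy.\<close>

lemma join_algebra_cond_ent_approx:
  fixes e :: real
  assumes P: "finite_events M P" and A: "A \<in> join_algebra M T P D" and "0 < e"
  obtains K where "finite K" "K \<subseteq> D" "cond_ent M {A, space M - A} (tr P K) < e"
proof -
  have As: "A \<in> sets M" using A by (simp add: join_algebra_def)
  obtain d where d: "0 < d" "\<And>A. A \<in> sets M \<Longrightarrow> prob A < d \<Longrightarrow> ent M {A} < e"
    using ent_singleton_small[OF \<open>0 < e\<close>] by blast
  obtain K B where K: "finite K" "K \<subseteq> D" "B \<in> sigma_sets (space M) (tr P K)" "prob (sym_diff A B) < d"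
    using join_algebra_sets_approx[OF _ A d(1)] P by blast
  have "B \<in> sets M"
    using K(3) P sets.sigma_sets_subset[OF tr_sets[of P K]] by blast
  then have "ent M {sym_diff A B} < e"
    using As K(4) by (intro d(2)) auto
  moreover have "cond_ent M {A} (tr P K) \<le> ent M {sym_diff A B}"
    using As K P by (intro cond_ent_le_ent_sym_diff tr_events)
  ultimately show thesis
    using that[OF K(1,2)] by (simp add: cond_ent_with_complement)
qed

lemma join_algebraI_cond_ent:
  assumes P: "finite_events M P" and A: "A \<in> sets M"
    and approx: "\<And>e::real. 0 < e \<Longrightarrow>
      \<exists>K. finite K \<and> K \<subseteq> D \<and> cond_ent M {A, space M - A} (tr P K) < e"
  shows "A \<in> join_algebra M T P D"
proof (rule join_algebraI_sets_approx[OF _ A])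
  fix e :: real assume "0 < e"
  then obtain K where K: "finite K" "K \<subseteq> D" "cond_ent M {A} (tr P K) < ln 2 * e"
    using approx[of "ln 2 * e"] by (auto simp: cond_ent_with_complement)
  obtain B where B: "B \<in> sigma_sets (space M) (tr P K)" "ln 2 * prob (sym_diff A B) \<le> cond_ent M {A} (tr P K)"
    using cond_ent_ge_sym_diff[OF A tr_events[OF P K(1)]] .
  have "ln 2 * prob (sym_diff A B) < ln 2 * e" by (rule le_less_trans[OF B(2) K(3)])
  then have "prob (sym_diff A B) < e" by simp
  moreover have "B \<in> sigma_sets (space M) (tr P D)"
    using B(1) sigma_sets_mono'[OF tr_mono[OF order_refl K(2)]] by blast
  ultimately show "\<exists>B\<in>sigma_sets (space M) (tr P D). prob (sym_diff A B) < e" by blast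
qed (use P in simp)

lemma finite_sigma_sets:
  assumes "finite_events M C"
  shows "finite (sigma_sets (space M) C)"
proof (rule finite_subset)
  show "sigma_sets (space M) C \<subseteq> Union ` Pow (cell M C ` space M)"
  proof
    fix A assume A: "A \<in> sigma_sets (space M) C"
    then have "A \<subseteq> space M"
      using assms sets.sigma_sets_subset[of C M] sets.sets_into_space[of A M] by blast
    then have "A = \<Union>{s \<in> cell M C ` space M. s \<subseteq> A}"
      using agree_sigma_sets[OF A] mem_cell_self[of _ M C] by blast
    then show "A \<in> Union ` Pow (cell M C ` space M)" by (rule image_eqI) auto
  qed
qed (use assms in \<open>simp add: finite_cells\<close>)

text \<open>There are countably many finite \<open>K\<close>, each generating finitely many events
  \<open>B\<close>. For each \<open>B\<close> and each tolerance one nearby member of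
  \<open>S\<close> is selected, if there is one. The dense set has to lie inside \<open>S\<close>,
  since almost sure statements will be known for members of \<open>S\<close> only.\<close>

lemma join_algebra_countable_dense:
  assumes P: "finite_events M P" and S: "S \<subseteq> join_algebra M T P UNIV"
  obtains S' where "countable S'" "S' \<subseteq> S"
    "\<And>A e::real. A \<in> S \<Longrightarrow> 0 < e \<Longrightarrow> \<exists>A'\<in>S'. prob (sym_diff A A') < e"
proof -
  let ?K = "\<Union>K\<in>{K::'g set. finite K}. sigma_sets (space M) (tr P K)"
  define near where "near B k A \<longleftrightarrow> A \<in> S \<and> prob (sym_diff A B) < 1 / real (Suc k)" for B k A
  define I where "I = {(B, k). B \<in> ?K \<and> (\<exists>A. near B k A)}"
  define S' where "S' = (\<lambda>(B, k). SOME A. near B k A) ` I"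
  have Ss: "S \<subseteq> sets M" using S by (auto simp: join_algebra_def)
  have near_some: "near B k (SOME A. near B k A)" if "(B, k) \<in> I" for B k
  proof -
    have "\<exists>A. near B k A" using that by (simp add: I_def)
    then show ?thesis by (rule someI_ex)
  qed
  have "countable ?K"
  proof (rule countable_UN[OF countable_Collect_finite])
    fix K :: "'g set" assume "K \<in> {K. finite K}"
    then show "countable (sigma_sets (space M) (tr P K))"
      using P by (intro countable_finite finite_sigma_sets tr_events) auto
  qed
  then have "countable (?K \<times> (UNIV::nat set))" by (intro countable_SIGMA) auto
  moreover have "I \<subseteq> ?K \<times> UNIV" unfolding I_def by blast
  ultimately have "countable I" by (rule countable_subset[rotated])
  then have "countable S'" unfolding S'_def by (rule countable_image)
  moreover have "S' \<subseteq> S"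
  proof
    fix A assume "A \<in> S'"
    then obtain B k where "(B, k) \<in> I" "A = (SOME A. near B k A)" by (auto simp: S'_def)
    with near_some[of B k] show "A \<in> S" by (simp add: near_def)
  qed
  moreover have "\<exists>A'\<in>S'. prob (sym_diff A A') < e" if A: "A \<in> S" and e: "0 < e" for A and e :: real
  proof -
    obtain k where k: "1 / real (Suc k) < e / 2"
      using nat_approx_posE[of "e / 2"] e by auto
    have "0 < 1 / real (Suc k)" by simp
    obtain K B where K: "finite K" "B \<in> sigma_sets (space M) (tr P K)" "prob (sym_diff A B) < 1 / real (Suc k)"
      using P by (elim conjE join_algebra_sets_approx[OF _ subsetD[OF S A] \<open>0 < 1 / real (Suc k)\<close>])
    have "near B k A" using A K(3) by (simp add: near_def)
    then have "(B, k) \<in> I" using K by (auto simp: I_def)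
    define A' where "A' = (SOME A. near B k A)"
    have A': "A' \<in> S'" "A' \<in> S" "prob (sym_diff A' B) < 1 / real (Suc k)"
    proof -
      have "near B k A'" unfolding A'_def by (rule near_some) fact
      then show "A' \<in> S" "prob (sym_diff A' B) < 1 / real (Suc k)" by (simp_all add: near_def)
      show "A' \<in> S'" unfolding A'_def S'_def by (rule image_eqI[OF _ \<open>(B, k) \<in> I\<close>]) simp
    qed
    have s: "A \<in> sets M" "A' \<in> sets M" "B \<in> sets M"
      using A A'(2) Ss K(2) P sets.sigma_sets_subset[OF tr_sets[of P K]] by blast+
    have "prob (sym_diff A A') \<le> prob (sym_diff A B \<union> sym_diff A' B)"
      using s by (intro finite_measure_mono) auto
    also have "\<dots> \<le> prob (sym_diff A B) + prob (sym_diff A' B)"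
      using s by (intro measure_Un_le) auto
    finally have "prob (sym_diff A A') < e" using K(3) A'(3) k by simp
    with A'(1) show ?thesis by blast
  qed
  ultimately show thesis by (rule that)
qed

end

section \<open>Orders of type Z and Folner sequences\<close>

definition below :: "'g order_rel \<Rightarrow> 'g \<Rightarrow> 'g set" where
  "below r a = {h. r (h, a)}"

lemma Z_orders_trans: "r \<in> Z_orders \<Longrightarrow> r (a, b) \<Longrightarrow> r (b, c) \<Longrightarrow> r (a, c)"
  unfolding Z_orders_def strict_linear_order_on_def trans_def by blast

lemma Z_orders_irrefl: "r \<in> Z_orders \<Longrightarrow> \<not> r (a, a)"
  unfolding Z_orders_def strict_linear_order_on_def irrefl_def by blast

lemma Z_orders_total: "r \<in> Z_orders \<Longrightarrow> a \<noteq> b \<Longrightarrow> r (a, b) \<or> r (b, a)"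
  unfolding Z_orders_def strict_linear_order_on_def total_on_def by blast

lemma Z_orders_asym: "r \<in> Z_orders \<Longrightarrow> r (a, b) \<Longrightarrow> \<not> r (b, a)"
  using Z_orders_trans[of r a b a] Z_orders_irrefl[of r a] by blast

lemma Z_orders_finite: "r \<in> Z_orders \<Longrightarrow> r (a, b) \<Longrightarrow> finite (order_interval r a b)"
  unfolding Z_orders_def by blast

lemma Z_orders_unbounded: "r \<in> Z_orders \<Longrightarrow> \<exists>b. r (b, a)" "r \<in> Z_orders \<Longrightarrow> \<exists>b. r (a, b)"
  unfolding Z_orders_def by blast+

text \<open>Stated for an arbitrary relation, so that greatest elements are obtained from the
  converse order.\<close>

lemma finite_least:
  assumes "finite S" "S \<noteq> {}"
    and trans: "\<And>a b c. Q a b \<Longrightarrow> Q b c \<Longrightarrow> Q a c" and total: "\<And>a b. a \<noteq> b \<Longrightarrow> Q a b \<or> Q b a"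
  shows "\<exists>m\<in>S. \<forall>x\<in>S. x = m \<or> Q m x"
  using assms(1,2)
proof (induction rule: finite_ne_induct)
  case (insert x F)
  then obtain m where m: "m \<in> F" "\<forall>y\<in>F. y = m \<or> Q m y" by blast
  show ?case
  proof (cases "Q m x \<or> m = x")
    case False
    then have "Q x m" using total by blast
    then have "\<forall>y\<in>insert x F. y = x \<or> Q x y" using m(2) trans[of x m] by auto
    then show ?thesis by blast
  qed (use m in blast)
qed simp

lemma Z_orders_least:
  assumes r: "r \<in> Z_orders" and S: "finite S" "S \<noteq> {}"
  obtains m where "m \<in> S" "\<And>x. x \<in> S \<Longrightarrow> x = m \<or> r (m, x)"
proof -
  have "\<exists>m\<in>S. \<forall>x\<in>S. x = m \<or> r (m, x)"
    by (rule finite_least[OF S]) (fact Z_orders_trans[OF r], fact Z_orders_total[OF r])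
  then show thesis using that by blast
qed

lemma Z_orders_greatest:
  assumes r: "r \<in> Z_orders" and S: "finite S" "S \<noteq> {}"
  obtains m where "m \<in> S" "\<And>x. x \<in> S \<Longrightarrow> x = m \<or> r (x, m)"
proof -
  have "\<exists>m\<in>S. \<forall>x\<in>S. x = m \<or> r (x, m)"
    by (rule finite_least[OF S]) (use Z_orders_trans[OF r] Z_orders_total[OF r] in blast)+
  then show thesis using that by blast
qed

section \<open>Successors and the enumeration by the integers\<close>

lemma successor_exists:
  assumes r: "r \<in> Z_orders"
  shows "\<exists>b. is_successor r a b"
proof -
  obtain c where c: "r (a, c)" using Z_orders_unbounded(2)[OF r] by blast
  let ?S = "{g. r (a, g) \<and> (r (g, c) \<or> g = c)}"
  have "?S \<subseteq> order_interval r a c" by (auto simp: order_interval_def)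
  then have "finite ?S" using Z_orders_finite[OF r c] by (rule finite_subset)
  moreover have "?S \<noteq> {}" using c by blast
  ultimately obtain b where b: "b \<in> ?S" "\<And>x. x \<in> ?S \<Longrightarrow> x = b \<or> r (b, x)"
    using Z_orders_least[OF r] by blast
  have "\<not> (r (a, x) \<and> r (x, b))" for x
  proof
    assume x: "r (a, x) \<and> r (x, b)"
    then have "x \<in> ?S" using b(1) Z_orders_trans[OF r] by blast
    then have "x = b \<or> r (b, x)" by (rule b(2))
    then show False using x Z_orders_asym[OF r] by blast
  qed
  with b(1) show ?thesis unfolding is_successor_def by blast
qed

lemma predecessor_exists:
  assumes r: "r \<in> Z_orders"
  shows "\<exists>a. is_successor r a b"
proof -
  obtain c where c: "r (c, b)" using Z_orders_unbounded(1)[OF r] by blast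
  let ?S = "{g. r (g, b) \<and> (r (c, g) \<or> g = c)}"
  have "?S \<subseteq> order_interval r c b" by (auto simp: order_interval_def)
  then have "finite ?S" using Z_orders_finite[OF r c] by (rule finite_subset)
  moreover have "?S \<noteq> {}" using c by blast
  ultimately obtain a where a: "a \<in> ?S" "\<And>x. x \<in> ?S \<Longrightarrow> x = a \<or> r (x, a)"
    using Z_orders_greatest[OF r] by blast
  have "\<not> (r (a, x) \<and> r (x, b))" for x
  proof
    assume x: "r (a, x) \<and> r (x, b)"
    then have "x \<in> ?S" using a(1) Z_orders_trans[OF r] by blast
    then have "x = a \<or> r (x, a)" by (rule a(2))
    then show False using x Z_orders_asym[OF r] by blast
  qed
  with a(1) show ?thesis unfolding is_successor_def by blast
qed

lemma successor_unique:
  assumes r: "r \<in> Z_orders"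
  shows "is_successor r a b \<Longrightarrow> is_successor r a c \<Longrightarrow> b = c"
    and "is_successor r a c \<Longrightarrow> is_successor r b c \<Longrightarrow> a = b"
  unfolding is_successor_def using Z_orders_total[OF r] by blast+

lemma successor_chain_mono:
  fixes f :: "int \<Rightarrow> 'g"
  assumes r: "r \<in> Z_orders" and f: "\<forall>i. is_successor r (f i) (f (i + 1))" and "i < j"
  shows "r (f i, f j)"
proof -
  have "r (f i, f (i + 1 + int n))" for n
  proof (induction n)
    case (Suc n)
    then show ?case
      using Z_orders_trans[OF r] f[rule_format, of "i + 1 + int n"] by (auto simp: is_successor_def algebra_simps)
  qed (use f[rule_format, of i] in \<open>simp add: is_successor_def\<close>)
  from this[of "nat (j - i - 1)"] \<open>i < j\<close> show ?thesis by simp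
qed

text \<open>The chain cannot jump over a missed element \<open>g\<close>, so one half of it stays
  between \<open>f 0\<close> and \<open>g\<close>. These are infinitely many elements in a finite
  order interval.\<close>

lemma successor_chain_surj:
  fixes f :: "int \<Rightarrow> 'g"
  assumes r: "r \<in> Z_orders" and f: "\<forall>i. is_successor r (f i) (f (i + 1))"
  shows "g \<in> range f"
proof (rule ccontr)
  assume g: "g \<notin> range f"
  note mono = successor_chain_mono[OF r f]
  have inj: "inj f"
    by (rule injI) (metis Z_orders_irrefl[OF r] mono linorder_neqE)
  have "r (f 0, g) \<or> r (g, f 0)"
    using g Z_orders_total[OF r] by blast
  then show False
  proof
    assume g0: "r (f 0, g)"
    have up: "r (f (int n), g)" for n
    proof (induction n)
      case (Suc n)
      have "f (int n + 1) \<noteq> g" using g by blast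
      then have "r (f (int n + 1), g) \<or> r (g, f (int n + 1))" using Z_orders_total[OF r] by blast
      with Suc f[rule_format, of "int n"] show ?case by (auto simp: is_successor_def add.commute)
    qed (use g0 in simp)
    have "f (int n) \<in> order_interval r (f 0) g" for n
      using up[of n] mono[of 0 "int n"] by (cases "n = 0") (auto simp: order_interval_def)
    then have "range (\<lambda>n. f (int n)) \<subseteq> order_interval r (f 0) g" by blast
    then have "finite (range (\<lambda>n. f (int n)))"
      using Z_orders_finite[OF r g0] by (rule finite_subset)
    moreover have "inj (\<lambda>n. f (int n))" by (rule injI) (use inj in \<open>simp add: inj_eq\<close>)
    ultimately show False using finite_imageD infinite_UNIV_nat by blast
  next
    assume g0: "r (g, f 0)"
    have down: "r (g, f (- int n))" for n
    proof (induction n)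
      case (Suc n)
      have "f (- int n - 1) \<noteq> g" using g by blast
      then have "r (f (- int n - 1), g) \<or> r (g, f (- int n - 1))" using Z_orders_total[OF r] by blast
      moreover have eq: "- int (Suc n) = - int n - 1" by simp
      ultimately show ?case
        unfolding eq using Suc f[rule_format, of "- int n - 1"] by (auto simp: is_successor_def)
    qed (use g0 in simp)
    have "f (- int n) \<in> order_interval r g (f 0)" for n
      using down[of n] mono[of "- int n" 0] by (cases "n = 0") (auto simp: order_interval_def)
    then have "range (\<lambda>n. f (- int n)) \<subseteq> order_interval r g (f 0)" by blast
    then have "finite (range (\<lambda>n. f (- int n)))"
      using Z_orders_finite[OF r g0] by (rule finite_subset)
    moreover have "inj (\<lambda>n. f (- int n))" by (rule injI) (use inj in \<open>simp add: inj_eq\<close>)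
    ultimately show False using finite_imageD infinite_UNIV_nat by blast
  qed
qed

lemma successor_chain_exists:
  assumes r: "r \<in> Z_orders"
  shows "\<exists>f :: int \<Rightarrow> 'g::group_add. f 0 = 0 \<and> (\<forall>i. is_successor r (f i) (f (i + 1)))"
proof -
  obtain sc where sc: "\<And>a. is_successor r a (sc a)" using successor_exists[OF r] by metis
  obtain pr where pr: "\<And>a. is_successor r (pr a) a" using predecessor_exists[OF r] by metis
  define f :: "int \<Rightarrow> 'g" where
    "f i = (if 0 \<le> i then (sc ^^ nat i) 0 else (pr ^^ nat (- i)) 0)" for i
  have "is_successor r (f i) (f (i + 1))" for i
  proof (cases "0 \<le> i")
    case True
    then have "nat (i + 1) = Suc (nat i)" by simp
    with True have "f (i + 1) = sc (f i)" by (simp add: f_def)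
    then show ?thesis by (simp add: sc)
  next
    case False
    then have "nat (- i) = Suc (nat (- (i + 1)))" by simp
    moreover have "f (i + 1) = (pr ^^ nat (- (i + 1))) 0"
      using False by (auto simp: f_def)
    ultimately have "f i = pr (f (i + 1))" using False by (simp add: f_def del: minus_add_distrib)
    then show ?thesis by (simp add: pr)
  qed
  moreover have "f 0 = 0" by (simp add: f_def)
  ultimately show ?thesis by blast
qed

lemma successor_chain_unique:
  fixes f f' :: "int \<Rightarrow> 'g"
  assumes r: "r \<in> Z_orders" and f: "\<forall>i. is_successor r (f i) (f (i + 1))"
    and f': "\<forall>i. is_successor r (f' i) (f' (i + 1))" and "f 0 = f' 0"
  shows "f = f'"
proof
  have up: "f (int n) = f' (int n)" for n
  proof (induction n)
    case (Suc n)
    then show ?case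
      using successor_unique(1)[OF r f[rule_format, of "int n"]] f'[rule_format, of "int n"] by (simp add: add.commute)
  qed (use assms(4) in simp)
  have down: "f (- int n) = f' (- int n)" for n
  proof (induction n)
    case (Suc n)
    moreover have eq: "- int (Suc n) = - int n - 1" by simp
    ultimately show ?case unfolding eq
      using successor_unique(2)[OF r, of "f (- int n - 1)" "f (- int n)" "f' (- int n - 1)"]
        f[rule_format, of "- int n - 1"] f'[rule_format, of "- int n - 1"] by simp
  qed (use assms(4) in simp)
  show "f i = f' i" for i
    using up[of "nat i"] down[of "nat (- i)"] by (cases "0 \<le> i") auto
qed

lemma order_enum_chain:
  fixes r :: "'g::group_add order_rel"
  assumes r: "r \<in> Z_orders"
  shows "order_enum r 0 = 0" "\<forall>i. is_successor r (order_enum r i) (order_enum r (i + 1))"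
proof -
  obtain f :: "int \<Rightarrow> 'g" where f: "f 0 = 0" "\<forall>i. is_successor r (f i) (f (i + 1))"
    using successor_chain_exists[OF r] by blast
  have "inj f"
    by (rule injI) (metis Z_orders_irrefl[OF r] successor_chain_mono[OF r f(2)] linorder_neqE)
  then have "bij f"
    using successor_chain_surj[OF r f(2)] by (auto simp: bij_def)
  then have "order_enum r = f"
    unfolding order_enum_def
    by (intro the_equality) (auto simp: f intro!: successor_chain_unique[OF r])
  with f show "order_enum r 0 = 0" "\<forall>i. is_successor r (order_enum r i) (order_enum r (i + 1))"
    by simp_all
qed

text \<open>The closed ray ending at position \<open>- n\<close> is the open ray below position
  \<open>1 - n\<close>.\<close>

lemma order_past_eq_below:
  assumes r: "r \<in> Z_orders"
  shows "order_past r n = below r (order_enum r (1 - int n))"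
proof -
  let ?f = "order_enum r"
  have mono: "r (?f i, ?f j)" if "i < j" for i j
    using that by (rule successor_chain_mono[OF r order_enum_chain(2)[OF r]])
  have iff: "?f i \<in> below r (?f (1 - int n)) \<longleftrightarrow> i \<le> - int n" for i
  proof (cases "i \<le> - int n")
    case True
    then show ?thesis using mono[of i "1 - int n"] by (simp add: below_def)
  next
    case False
    then have "i = 1 - int n \<or> 1 - int n < i" by linarith
    then have "\<not> r (?f i, ?f (1 - int n))"
      using mono[of "1 - int n" i] Z_orders_asym[OF r] Z_orders_irrefl[OF r] by blast
    with False show ?thesis by (simp add: below_def)
  qed
  show ?thesis
  proof (intro set_eqI)
    fix h
    obtain i where "h = ?f i"
      using successor_chain_surj[OF r order_enum_chain(2)[OF r], of h] by blast
    moreover have "?f i = ?f j \<longleftrightarrow> i = j" for i j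
      using mono[of i j] mono[of j i] Z_orders_irrefl[OF r] by (metis linorder_neqE)
    ultimately show "h \<in> order_past r n \<longleftrightarrow> h \<in> below r (?f (1 - int n))"
      by (auto simp: order_past_def iff)
  qed
qed

text \<open>The cut point is at position \<open>1 - int n\<close>, hence at or before the unit; it
  is the unit itself when \<open>n = 1\<close>.\<close>

lemma order_past_below_origin:
  assumes r: "r \<in> Z_orders" and "1 \<le> n"
  obtains a where "\<not> r (0, a)" "order_past r n = below r a"
proof
  let ?a = "order_enum r (1 - int n)"
  show "order_past r n = below r ?a" by (rule order_past_eq_below[OF r])
  show "\<not> r (0, ?a)"
  proof (cases "n = 1")
    case False
    then have "r (?a, order_enum r 0)"
      using \<open>1 \<le> n\<close> by (intro successor_chain_mono[OF r order_enum_chain(2)[OF r]]) simp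
    then show ?thesis using Z_orders_asym[OF r] by (simp add: order_enum_chain(1)[OF r])
  qed (simp add: order_enum_chain(1)[OF r] Z_orders_irrefl[OF r])
qed

lemma order_past_subset_below:
  assumes r: "r \<in> Z_orders"
  obtains n where "1 \<le> n" "order_past r n \<subseteq> below r b"
proof -
  obtain j where j: "b = order_enum r j"
    using successor_chain_surj[OF r order_enum_chain(2)[OF r]] by blast
  \<comment> \<open>Any \<open>n \<ge> 2 - j\<close> places \<open>1 - int n\<close> strictly before
    the position \<open>j\<close> of \<open>b\<close>.\<close>
  define n where "n = nat (max 1 (2 - j))"
  have n: "1 \<le> n" "1 - int n < j" by (auto simp: n_def)
  have "r (order_enum r (1 - int n), b)"
    unfolding j using n(2) by (intro successor_chain_mono[OF r order_enum_chain(2)[OF r]])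
  then have "order_past r n \<subseteq> below r b"
    unfolding order_past_eq_below[OF r] below_def using Z_orders_trans[OF r] by blast
  with n(1) show thesis by (rule that)
qed

text \<open>The block \<open>I\<close> consists of the elements from \<open>a\<close> up to some
  member of \<open>K\<close>. It is finite because intervals are finite, it captures what
  \<open>K\<close> has outside the past of \<open>a\<close>, and it leaves no gap between that past
  and its own elements.\<close>

lemma Z_orders_cover:
  assumes r: "r \<in> Z_orders" and K: "finite K"
  obtains I where "finite I" "\<forall>h\<in>I. \<not> r (h, a)" "\<forall>k\<in>K. r (k, a) \<or> k \<in> I"
    "\<forall>g\<in>I. \<forall>h. r (h, g) \<longrightarrow> r (h, a) \<or> h \<in> I"
proof
  let ?J = "\<lambda>k. {h. \<not> r (h, a) \<and> (h = k \<or> r (h, k))}"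
  let ?I = "\<Union>k\<in>K. ?J k"
  have "finite (?J k)" for k
  proof (cases "r (a, k)")
    case True
    have "?J k \<subseteq> order_interval r a k"
      using Z_orders_total[OF r] by (auto simp: order_interval_def)
    then show ?thesis using Z_orders_finite[OF r True] by (rule finite_subset)
  next
    case False
    have "?J k \<subseteq> {k}"
    proof
      fix h assume h: "h \<in> ?J k"
      show "h \<in> {k}"
      proof (rule ccontr)
        assume "h \<notin> {k}"
        with h have "r (h, k)" "\<not> r (h, a)" by auto
        then show False
          using False Z_orders_total[OF r, of a h] Z_orders_trans[OF r, of a h k] by auto
      qed
    qed
    then show ?thesis by (rule finite_subset) simp
  qed
  then show "finite ?I" using K by blast
  show "\<forall>h\<in>?I. \<not> r (h, a)" by blast
  show "\<forall>k\<in>K. r (k, a) \<or> k \<in> ?I" by blast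
  show "\<forall>g\<in>?I. \<forall>h. r (h, g) \<longrightarrow> r (h, a) \<or> h \<in> ?I"
    using Z_orders_trans[OF r] by blast
qed

section \<open>Folner sequences\<close>

lemma folner_eventually_nonempty:
  assumes "folner_sequence F"
  shows "eventually (\<lambda>n. F n \<noteq> {}) sequentially"
proof -
  have "(\<lambda>n. real (card (F n \<inter> (\<lambda>x. 0 + x) ` F n)) / real (card (F n))) \<longlonglongrightarrow> 1"
    using assms unfolding folner_sequence_def by blast
  \<comment> \<open>For empty \<open>F n\<close> the quotient has the default value
    \<open>0 / 0 = 0\<close>, far from the limit 1.\<close>
  then have "eventually (\<lambda>n. 0 < real (card (F n \<inter> (\<lambda>x. 0 + x) ` F n)) / real (card (F n))) sequentially"
    by (rule order_tendstoD) simp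
  then show ?thesis by eventually_elim auto
qed

text \<open>For a single \<open>k\<close>, the elements \<open>g\<close> with \<open>k + g\<close>
  outside \<open>F n\<close> are counted by the deficit of the Folner quotient for \<open>k\<close>.
  A union bound over the finite set \<open>K\<close> finishes.\<close>

lemma folner_boundary:
  fixes F :: "nat \<Rightarrow> 'g::group_add set"
  assumes F: "folner_sequence F" and K: "finite K"
  shows "(\<lambda>n. real (card {g \<in> F n. \<not> (\<lambda>k. k + g) ` K \<subseteq> F n}) / real (card (F n))) \<longlonglongrightarrow> 0"
proof (rule tendsto_sandwich[OF _ _ tendsto_const])
  have fin: "finite (F n)" for n using F by (simp add: folner_sequence_def)
  let ?q = "\<lambda>k n. real (card (F n \<inter> (\<lambda>x. k + x) ` F n)) / real (card (F n))"
  have "(\<lambda>n. \<Sum>k\<in>K. 1 - ?q k n) \<longlonglongrightarrow> (\<Sum>k\<in>K. 1 - 1)"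
    using F by (intro tendsto_sum tendsto_diff tendsto_const) (auto simp: folner_sequence_def)
  then show "(\<lambda>n. \<Sum>k\<in>K. 1 - ?q k n) \<longlonglongrightarrow> 0" by simp
  show "eventually (\<lambda>n. real (card {g \<in> F n. \<not> (\<lambda>k. k + g) ` K \<subseteq> F n}) / real (card (F n))
      \<le> (\<Sum>k\<in>K. 1 - ?q k n)) sequentially"
    using folner_eventually_nonempty[OF F]
  proof eventually_elim
    fix n assume ne: "F n \<noteq> {}"
    have bad: "real (card {g \<in> F n. k + g \<notin> F n}) = real (card (F n)) - real (card (F n \<inter> (\<lambda>x. k + x) ` F n))" for k
    proof -
      have "card {g \<in> F n. k + g \<in> F n} = card ((\<lambda>x. k + x) ` {g \<in> F n. k + g \<in> F n})"
        by (intro card_image[symmetric]) (simp add: inj_on_def)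
      also have "(\<lambda>x. k + x) ` {g \<in> F n. k + g \<in> F n} = F n \<inter> (\<lambda>x. k + x) ` F n" by auto
      finally have "card {g \<in> F n. k + g \<in> F n} = card (F n \<inter> (\<lambda>x. k + x) ` F n)" .
      moreover have "card (F n) = card {g \<in> F n. k + g \<in> F n} + card {g \<in> F n. k + g \<notin> F n}"
        using fin by (subst card_Un_disjoint[symmetric]) (auto intro: arg_cong[where f=card])
      ultimately show ?thesis by simp
    qed
    have "{g \<in> F n. \<not> (\<lambda>k. k + g) ` K \<subseteq> F n} = (\<Union>k\<in>K. {g \<in> F n. k + g \<notin> F n})" by auto
    then have "card {g \<in> F n. \<not> (\<lambda>k. k + g) ` K \<subseteq> F n} \<le> (\<Sum>k\<in>K. card {g \<in> F n. k + g \<notin> F n})"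
      using card_UN_le[OF K] by simp
    then have "real (card {g \<in> F n. \<not> (\<lambda>k. k + g) ` K \<subseteq> F n}) \<le> (\<Sum>k\<in>K. real (card {g \<in> F n. k + g \<notin> F n}))"
      by (simp flip: of_nat_sum)
    then have "real (card {g \<in> F n. \<not> (\<lambda>k. k + g) ` K \<subseteq> F n}) / real (card (F n))
        \<le> (\<Sum>k\<in>K. real (card {g \<in> F n. k + g \<notin> F n})) / real (card (F n))"
      by (rule divide_right_mono) simp
    also have "\<dots> = (\<Sum>k\<in>K. 1 - ?q k n)"
      unfolding bad sum_divide_distrib using ne fin[of n] by (simp add: diff_divide_distrib)
    finally show "real (card {g \<in> F n. \<not> (\<lambda>k. k + g) ` K \<subseteq> F n}) / real (card (F n))
      \<le> (\<Sum>k\<in>K. 1 - ?q k n)" .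
  qed
qed auto

section \<open>Common refinements of partitions as cells\<close>

lemma disjoint_mem_iff: "disjoint Q \<Longrightarrow> B \<in> Q \<Longrightarrow> x \<in> B \<Longrightarrow> A \<in> Q \<Longrightarrow> x \<in> A \<longleftrightarrow> A = B"
  unfolding disjoint_def by blast

text \<open>Choosing one member from each partition with a common point \<open>x\<close> amounts to
  recording which members contain \<open>x\<close>. This links \<open>join_partition\<close> to
  entropies of families of events.\<close>

lemma common_refinement_cells:
  assumes "\<P> \<noteq> {}" and part: "\<And>Q. Q \<in> \<P> \<Longrightarrow> disjoint Q \<and> \<Union>Q = space M"
  shows "common_refinement \<P> = cell M (\<Union>\<P>) ` space M"
proof -
  have X: "\<Inter>(f ` \<P>) = cell M (\<Union>\<P>) x" if f: "f \<in> (\<Pi> Q\<in>\<P>. Q)" and x: "x \<in> \<Inter>(f ` \<P>)" for f x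
  proof (rule set_eqI)
    fix y
    have fQ: "f Q \<in> Q" "x \<in> f Q" if "Q \<in> \<P>" for Q using that f x by blast+
    have xA: "x \<in> A \<longleftrightarrow> A = f Q" if "Q \<in> \<P>" "A \<in> Q" for A Q
      using disjoint_mem_iff[of Q "f Q" x A] part fQ that by simp
    have yA: "y \<in> A \<longleftrightarrow> A = f Q" if "Q \<in> \<P>" "A \<in> Q" "y \<in> f Q" for A Q
      using disjoint_mem_iff[of Q "f Q" y A] part fQ that by simp
    show "y \<in> \<Inter>(f ` \<P>) \<longleftrightarrow> y \<in> cell M (\<Union>\<P>) x"
    proof
      assume y: "y \<in> \<Inter>(f ` \<P>)"
      obtain Q where "Q \<in> \<P>" using assms(1) by blast
      then have "y \<in> \<Union>Q" using y fQ by blast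
      then have "y \<in> space M" using part[OF \<open>Q \<in> \<P>\<close>] by simp
      moreover have "x \<in> A \<longleftrightarrow> y \<in> A" if "A \<in> \<Union>\<P>" for A
      proof -
        obtain Q where "Q \<in> \<P>" "A \<in> Q" using \<open>A \<in> \<Union>\<P>\<close> by blast
        moreover have "y \<in> f Q" using y \<open>Q \<in> \<P>\<close> by blast
        ultimately show ?thesis by (simp add: xA yA)
      qed
      ultimately show "y \<in> cell M (\<Union>\<P>) x" by (simp add: cell_def)
    next
      assume y: "y \<in> cell M (\<Union>\<P>) x"
      have "y \<in> f Q" if "Q \<in> \<P>" for Q
      proof -
        have "f Q \<in> \<Union>\<P>" using fQ[OF that] that by blast
        then have "x \<in> f Q \<longleftrightarrow> y \<in> f Q" using y unfolding cell_def by blast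
        with fQ[OF that] show ?thesis by simp
      qed
      then show "y \<in> \<Inter>(f ` \<P>)" by blast
    qed
  qed
  show ?thesis
  proof (intro equalityI subsetI)
    fix s assume "s \<in> common_refinement \<P>"
    then obtain f x where f: "f \<in> (\<Pi> Q\<in>\<P>. Q)" "s = \<Inter>(f ` \<P>)" "x \<in> s"
      by (auto simp: common_refinement)
    moreover have "x \<in> space M"
    proof -
      obtain Q where "Q \<in> \<P>" using assms(1) by blast
      then show ?thesis using f part[of Q] by blast
    qed
    ultimately show "s \<in> cell M (\<Union>\<P>) ` space M" using X[of f x] by simp
  next
    fix s assume "s \<in> cell M (\<Union>\<P>) ` space M"
    then obtain x where x: "x \<in> space M" "s = cell M (\<Union>\<P>) x" by blast
    have "\<exists>A. A \<in> Q \<and> x \<in> A" if "Q \<in> \<P>" for Q using part[OF that] x(1) by blast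
    then obtain f where "\<And>Q. Q \<in> \<P> \<Longrightarrow> f Q \<in> Q \<and> x \<in> f Q" by metis
    then have "f \<in> (\<Pi> Q\<in>\<P>. Q)" "x \<in> \<Inter>(f ` \<P>)" by auto
    then have "s = \<Inter>(f ` \<P>)" "s \<noteq> {}" using X[of f x] x(2) by auto
    with \<open>f \<in> (\<Pi> Q\<in>\<P>. Q)\<close> show "s \<in> common_refinement \<P>"
      unfolding common_refinement by blast
  qed
qed

lemma (in measure_preserving) partition_entropy_join_partition:
  assumes "D \<noteq> {}" "disjoint R" "\<Union>R = space M"
  shows "partition_entropy M (join_partition M T R D) = ent M (tr R D)"
proof -
  have "common_refinement (pb R ` D) = cell M (\<Union>(pb R ` D)) ` space M"
  proof (rule common_refinement_cells)
    fix Q assume "Q \<in> pb R ` D"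
    then obtain g where g: "Q = pb R g" by blast
    have "disjoint Q"
      using assms(2) unfolding g pullback_def disjoint_def by blast
    moreover have "\<Union>Q = space M"
      using assms(3) T_space unfolding g pullback_def by blast
    ultimately show "disjoint Q \<and> \<Union>Q = space M" ..
  qed (use assms in simp)
  then show ?thesis by (simp add: join_partition_def ent_def translates_def)
qed

section \<open>Chain rules along an order\<close>

text \<open>The past of \<open>g\<close> in an order is a right translate of the past of the unit in
  the shifted order. Through this identity, terms indexed by \<open>g\<close> become values of one
  function along the orbit of the order.\<close>

lemma below_order_action: "below r g = (\<lambda>h. h + g) ` below (order_action g r) 0"
proof -
  have "h \<in> (\<lambda>h. h + g) ` below (order_action g r) 0" if "r (h, g)" for h
    by (rule image_eqI[of _ _ "h - g"]) (use that in \<open>simp_all add: below_def order_action_def\<close>)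
  then show ?thesis by (auto simp: below_def order_action_def)
qed

context measure_preserving
begin

text \<open>Split off the greatest element of \<open>F\<close>: all other elements lie in its past,
  and it lies in the past of none of them.\<close>

lemma cond_ent_chain_order:
  assumes r: "r \<in> Z_orders" and "finite F"
  shows "cond_ent M (tr C F) E = (\<Sum>g\<in>F. cond_ent M (pb C g) (E \<union> tr C (F \<inter> below r g)))"
  using assms(2)
proof (induction "card F" arbitrary: F)
  case 0
  then show ?case by (simp add: cond_ent_def)
next
  case (Suc k)
  then have "F \<noteq> {}" by auto
  then obtain m where m: "m \<in> F" "\<And>x. x \<in> F \<Longrightarrow> x = m \<or> r (x, m)"
    using Z_orders_greatest[OF r \<open>finite F\<close>] by blast
  define F' where "F' = F - {m}"
  have F: "F = insert m F'" "m \<notin> F'" "finite F'" using m(1) Suc.prems by (auto simp: F'_def)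
  have Fm: "F \<inter> below r m = F'"
    using m Z_orders_irrefl[OF r] by (auto simp: F'_def below_def)
  have Fg: "F \<inter> below r g = F' \<inter> below r g" if "g \<in> F'" for g
  proof -
    have "r (g, m)" using m(2)[of g] that by (auto simp: F'_def)
    then have "\<not> r (m, g)" by (rule Z_orders_asym[OF r])
    then show ?thesis by (auto simp: F(1) below_def)
  qed
  have "cond_ent M (tr C F) E = cond_ent M (tr C F' \<union> pb C m) E"
    by (simp add: F(1) tr_insert Un_commute)
  also have "\<dots> = cond_ent M (tr C F') E + cond_ent M (pb C m) (tr C F' \<union> E)"
    by (rule cond_ent_chain)
  also have "cond_ent M (tr C F') E = (\<Sum>g\<in>F'. cond_ent M (pb C g) (E \<union> tr C (F' \<inter> below r g)))"
    using Suc.hyps F by (intro Suc.hyps(1)) auto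
  also have "\<dots> = (\<Sum>g\<in>F'. cond_ent M (pb C g) (E \<union> tr C (F \<inter> below r g)))"
    by (intro sum.cong) (simp_all add: Fg)
  also have "cond_ent M (pb C m) (tr C F' \<union> E) = cond_ent M (pb C m) (E \<union> tr C (F \<inter> below r m))"
    by (simp add: Fm Un_commute)
  finally show ?case using F(2,3) by (simp add: F(1))
qed

text \<open>Each term of the chain rule is bounded below by the entropy given the full past in the
  richer family \<open>C'\<close>. The extra condition \<open>E\<close> costs nothing because, by
  \<open>small\<close>, it is determined by that past up to arbitrarily small entropy. It is applied
  with \<open>E\<close> empty, with \<open>E\<close> an event of zero entropy, and with
  \<open>E\<close> lying in the remote past.\<close>

lemma sum_cond_ent_on_le_cond_ent:
  assumes r: "r \<in> Z_orders" and I: "finite I"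
    and C: "finite_events M C" "finite_events M C'" "C \<subseteq> C'" and E: "finite_events M E"
    and L: "finite L" "\<And>g. g \<in> I \<Longrightarrow> L \<subseteq> below r g"
    and small: "\<And>g e::real. g \<in> I \<Longrightarrow> 0 < e \<Longrightarrow>
      \<exists>J. finite J \<and> J \<subseteq> below r g \<and> cond_ent M E (tr C' J) \<le> e"
  shows "(\<Sum>g\<in>I. cond_ent_on (pb C g) C' (below r g)) \<le> cond_ent M (tr C I) (E \<union> tr C L)"
  unfolding cond_ent_chain_order[OF r I]
proof (rule sum_mono, rule field_le_epsilon)
  fix g and e :: real assume g: "g \<in> I" and "0 < e"
  then obtain J where J: "finite J" "J \<subseteq> below r g" "cond_ent M E (tr C' J) \<le> e"
    using small[OF g \<open>0 < e\<close>] by blast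
  \<comment> \<open>Contains the indices already conditioned on, namely \<open>L\<close> and the
    part of \<open>I\<close> before \<open>g\<close>, together with \<open>J\<close>, which makes
    \<open>E\<close> nearly known.\<close>
  define X where "X = L \<union> (I \<inter> below r g) \<union> J"
  have X: "finite X" "X \<subseteq> below r g"
    using I L(1) J L(2)[OF g] by (auto simp: X_def)
  have ev: "finite_events M (tr C' X)" "finite_events M (E \<union> tr C' X)" "finite_events M (pb C g)"
    using tr_events[OF C(2) X(1)] E pb_events[OF C(1)] by blast+
  have "cond_ent_on (pb C g) C' (below r g) \<le> cond_ent M (pb C g) (tr C' X)"
    by (rule cond_ent_on_le[OF ev(3) C(2) X])
  moreover have "cond_ent M (pb C g) (tr C' X) - cond_ent M E (tr C' X) \<le> cond_ent M (pb C g) (E \<union> tr C' X)"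
    by (rule cond_ent_Un_ge[OF ev(3,1) E])
  moreover have "cond_ent M E (tr C' X) \<le> cond_ent M E (tr C' J)"
    by (rule cond_ent_antimono[OF E ev(1) tr_mono[OF order_refl]]) (simp add: X_def)
  moreover have "cond_ent M (pb C g) (E \<union> tr C' X) \<le> cond_ent M (pb C g) (E \<union> tr C L \<union> tr C (I \<inter> below r g))"
  proof (rule cond_ent_antimono[OF ev(3,2)])
    have "tr C (L \<union> (I \<inter> below r g)) \<subseteq> tr C' X"
      by (rule tr_mono[OF C(3)]) (simp add: X_def)
    then show "E \<union> tr C L \<union> tr C (I \<inter> below r g) \<subseteq> E \<union> tr C' X"
      unfolding tr_Un by blast
  qed
  ultimately show "cond_ent_on (pb C g) C' (below r g)
      \<le> cond_ent M (pb C g) (E \<union> tr C L \<union> tr C (I \<inter> below r g)) + e"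
    using J(3) by linarith
qed

text \<open>The counterpart from above. By convexity a nearly optimal finite past of
  \<open>g\<close> splits into a part below \<open>a\<close>, collected in \<open>L\<close>, and a
  part inside \<open>I\<close>, which the chain rule supplies.\<close>

lemma cond_ent_le_sum_cond_ent_on:
  fixes e :: real
  assumes r: "r \<in> Z_orders" and I: "finite I" and C: "finite_events M C" and "0 < e"
    and convex: "\<forall>g\<in>I. \<forall>h. r (h, g) \<longrightarrow> r (h, a) \<or> h \<in> I"
  obtains L where "finite L" "L \<subseteq> below r a"
    "\<forall>L'. finite L' \<longrightarrow> L \<subseteq> L' \<longrightarrow>
      cond_ent M (tr C I) (tr C L') \<le> (\<Sum>g\<in>I. cond_ent_on (pb C g) C (below r g)) + e"
proof -
  \<comment> \<open>The error is shared among the elements of \<open>I\<close>; adding 1 avoids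
    division by zero for empty \<open>I\<close>.\<close>
  let ?e = "e / (real (card I) + 1)"
  have "0 < ?e" using \<open>0 < e\<close> by (intro divide_pos_pos) auto
  then have "\<exists>J. finite J \<and> J \<subseteq> below r g \<and> cond_ent M (pb C g) (tr C J) < cond_ent_on (pb C g) C (below r g) + ?e" for g
    by (meson cond_ent_on_approx)
  then obtain J where J: "\<And>g. finite (J g)" "\<And>g. J g \<subseteq> below r g"
    "\<And>g. cond_ent M (pb C g) (tr C (J g)) < cond_ent_on (pb C g) C (below r g) + ?e"
    by metis
  define L where "L = (\<Union>g\<in>I. J g) \<inter> below r a"
  have "cond_ent M (tr C I) (tr C L') \<le> (\<Sum>g\<in>I. cond_ent_on (pb C g) C (below r g)) + e"
    if L': "finite L'" "L \<subseteq> L'" for L'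
  proof -
    have "cond_ent M (pb C g) (tr C L' \<union> tr C (I \<inter> below r g)) \<le> cond_ent_on (pb C g) C (below r g) + ?e"
      if g: "g \<in> I" for g
    proof -
      have "J g \<subseteq> L' \<union> (I \<inter> below r g)"
        using J(2)[of g] convex[rule_format, OF g] L'(2) g by (auto simp: L_def below_def)
      then have "cond_ent M (pb C g) (tr C (L' \<union> (I \<inter> below r g))) \<le> cond_ent M (pb C g) (tr C (J g))"
        using I L' by (intro cond_ent_antimono pb_events[OF C] tr_events[OF C] tr_mono) auto
      with J(3)[of g] show ?thesis by (simp add: tr_Un)
    qed
    then have "cond_ent M (tr C I) (tr C L') \<le> (\<Sum>g\<in>I. cond_ent_on (pb C g) C (below r g) + ?e)"
      unfolding cond_ent_chain_order[OF r I] by (rule sum_mono)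
    also have "\<dots> = (\<Sum>g\<in>I. cond_ent_on (pb C g) C (below r g)) + real (card I) * ?e"
      by (simp add: sum.distrib)
    also have "real (card I) * ?e \<le> e"
      using \<open>0 < e\<close> by (simp add: field_simps)
    finally show ?thesis by simp
  qed
  moreover have "finite L" "L \<subseteq> below r a"
    using I J(1) by (auto simp: L_def)
  ultimately show thesis using that by blast
qed

text \<open>This is e(Q | C, \<prec>), as a function of the order.\<close>

definition past_ent :: "'x set set \<Rightarrow> 'x set set \<Rightarrow> 'g order_rel \<Rightarrow> real" where
  "past_ent Q C r = cond_ent_on Q C (below r 0)"

lemma cond_ent_on_below:
  "finite_events M Q \<Longrightarrow> finite_events M C \<Longrightarrow>
    cond_ent_on (pb Q g) C (below r g) = past_ent Q C (order_action g r)"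
  using cond_ent_on_pb[of Q C g "below (order_action g r) 0"] below_order_action[of r g]
  by (simp add: past_ent_def)

lemma past_ent_nonneg: "finite_events M Q \<Longrightarrow> finite_events M C \<Longrightarrow> 0 \<le> past_ent Q C r"
  unfolding past_ent_def by (rule cond_ent_on_nonneg)

lemma past_ent_le: "finite_events M Q \<Longrightarrow> finite_events M C \<Longrightarrow> past_ent Q C r \<le> ent M Q"
  unfolding past_ent_def by (rule cond_ent_on_le_ent)

lemma cond_ent_empty: "cond_ent M C {} = ent M C"
  by (simp add: cond_ent_def ent_empty)

lemma sum_past_ent_le_ent:
  assumes r: "r \<in> Z_orders" and F: "finite F" and C: "finite_events M C"
  shows "(\<Sum>g\<in>F. past_ent C C (order_action g r)) \<le> ent M (tr C F)"
proof -
  have "(\<Sum>g\<in>F. cond_ent_on (pb C g) C (below r g)) \<le> cond_ent M (tr C F) ({} \<union> tr C {})"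
  proof (rule sum_cond_ent_on_le_cond_ent[OF r F C C])
    show "\<exists>J. finite J \<and> J \<subseteq> below r g \<and> cond_ent M {} (tr C J) \<le> e" if "0 < e" for g and e :: real
      using that by (intro exI[of _ "{}"]) (simp add: cond_ent_def)
  qed auto
  then show ?thesis using C by (simp add: cond_ent_on_below cond_ent_empty)
qed

text \<open>In the chain rule, an element \<open>g\<close> with its whole window inside
  \<open>F\<close> has the past part of that window in its condition. Each remaining element costs
  at most the entropy of \<open>C\<close>.\<close>

lemma ent_le_sum_window:
  assumes r: "r \<in> Z_orders" and F: "finite F" and K: "finite K" and C: "finite_events M C"
  shows "ent M (tr C F) \<le> (\<Sum>g\<in>F. cond_ent M C (tr C (K \<inter> below (order_action g r) 0)))
    + real (card {g \<in> F. \<not> (\<lambda>k. k + g) ` K \<subseteq> F}) * ent M C"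
proof -
  have "ent M (tr C F) = (\<Sum>g\<in>F. cond_ent M (pb C g) ({} \<union> tr C (F \<inter> below r g)))"
    unfolding cond_ent_chain_order[OF r F, symmetric] cond_ent_empty ..
  also have "\<dots> \<le> (\<Sum>g\<in>F. cond_ent M C (tr C (K \<inter> below (order_action g r) 0))
      + (if \<not> (\<lambda>k. k + g) ` K \<subseteq> F then ent M C else 0))"
  proof (rule sum_mono)
    fix g assume "g \<in> F"
    have ev: "finite_events M (pb C g)" "finite_events M (tr C (F \<inter> below r g))"
      "finite_events M (tr C (K \<inter> below (order_action g r) 0))"
      using F K by (auto intro!: pb_events[OF C] tr_events[OF C] simp del: finite_Int)
    show "cond_ent M (pb C g) ({} \<union> tr C (F \<inter> below r g))
      \<le> cond_ent M C (tr C (K \<inter> below (order_action g r) 0))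
        + (if \<not> (\<lambda>k. k + g) ` K \<subseteq> F then ent M C else 0)"
    proof (cases "(\<lambda>k. k + g) ` K \<subseteq> F")
      case True
      have "cond_ent M (pb C g) (tr C (F \<inter> below r g))
          \<le> cond_ent M (pb C g) (tr C ((\<lambda>h. h + g) ` (K \<inter> below (order_action g r) 0)))"
        using True by (intro cond_ent_antimono ev tr_mono) (auto simp: below_order_action[of r g])
      also have "\<dots> = cond_ent M C (tr C (K \<inter> below (order_action g r) 0))"
        unfolding pb_tr[symmetric] by (rule cond_ent_pb[OF C ev(3)])
      finally show ?thesis using True by simp
    next
      case False
      have "cond_ent M (pb C g) (tr C (F \<inter> below r g)) \<le> ent M C"
        using cond_ent_le_ent[OF ev(1,2)] by (simp add: ent_pb[OF C])
      with False cond_ent_nonneg[OF C ev(3)] show ?thesis by simp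
    qed
  qed
  also have "\<dots> = (\<Sum>g\<in>F. cond_ent M C (tr C (K \<inter> below (order_action g r) 0)))
      + real (card {g \<in> F. \<not> (\<lambda>k. k + g) ` K \<subseteq> F}) * ent M C"
    unfolding sum.distrib sum.inter_filter[OF F, symmetric] by simp
  finally show ?thesis .
qed

text \<open>By the chain rule only the entropy of the translates of \<open>R\<close> given those of
  \<open>P\<close> has to be added. Elements whose translate of \<open>K\<close> stays in
  \<open>F\<close> contribute at most \<open>e\<close>, the others at most the entropy of
  \<open>R\<close>.\<close>

lemma ent_tr_join_le:
  assumes F: "finite F" and K: "finite K" and P: "finite_events M P" and R: "finite_events M R"
    and e: "cond_ent M R (tr P K) \<le> e"
  shows "ent M (tr (P \<union> R) F) \<le> ent M (tr P F) + real (card F) * e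
    + real (card {g \<in> F. \<not> (\<lambda>k. k + g) ` K \<subseteq> F}) * ent M R"
proof -
  have evF: "finite_events M (tr P F)" by (rule tr_events[OF P F])
  have evK: "finite_events M (tr P K)" by (rule tr_events[OF P K])
  have "0 \<le> e" using cond_ent_nonneg[OF R evK] e by simp
  have "ent M (tr (P \<union> R) F) = ent M (tr P F) + cond_ent M (tr R F) (tr P F)"
    by (simp add: cond_ent_def tr_Un_left Un_commute)
  also have "cond_ent M (tr R F) (tr P F) \<le> (\<Sum>g\<in>F. cond_ent M (pb R g) (tr P F))"
    unfolding translates_def[of M T R F] by (intro cond_ent_UN_le F pb_events[OF R] evF)
  also have "\<dots> \<le> (\<Sum>g\<in>F. e + (if \<not> (\<lambda>k. k + g) ` K \<subseteq> F then ent M R else 0))"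
  proof (rule sum_mono)
    fix g assume "g \<in> F"
    show "cond_ent M (pb R g) (tr P F) \<le> e + (if \<not> (\<lambda>k. k + g) ` K \<subseteq> F then ent M R else 0)"
    proof (cases "(\<lambda>k. k + g) ` K \<subseteq> F")
      case True
      have "cond_ent M (pb R g) (tr P F) \<le> cond_ent M (pb R g) (tr P ((\<lambda>k. k + g) ` K))"
        by (rule cond_ent_antimono[OF pb_events[OF R] evF tr_mono[OF order_refl True]])
      also have "\<dots> = cond_ent M R (tr P K)"
        unfolding pb_tr[symmetric] by (rule cond_ent_pb[OF R evK])
      finally show ?thesis using True e by simp
    next
      case False
      have "cond_ent M (pb R g) (tr P F) \<le> ent M R"
        using cond_ent_le_ent[OF pb_events[OF R] evF] by (simp add: ent_pb[OF R])
      with False \<open>0 \<le> e\<close> show ?thesis by simp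
    qed
  qed
  also have "\<dots> = real (card F) * e + real (card {g \<in> F. \<not> (\<lambda>k. k + g) ` K \<subseteq> F}) * ent M R"
    unfolding sum.distrib sum.inter_filter[OF F, symmetric] by simp
  finally show ?thesis by simp
qed

text \<open>\<open>A\<close> is nearly determined by a past part \<open>L\<close> and a finite block
  \<open>I\<close> of the P-process. Knowing \<open>R\<close> does not change the entropy of the
  block given the past, so by symmetry the block hardly informs about \<open>R\<close>, and the past
  alone determines it.\<close>

lemma mem_join_algebra_below:
  assumes r: "r \<in> Z_orders" and P: "finite_events M P" and A: "A \<in> join_algebra M T P UNIV"
  defines "R \<equiv> {A, space M - A}"
  assumes R0: "\<And>g. past_ent R R (order_action g r) = 0"
    and PR: "\<And>g. past_ent P (P \<union> R) (order_action g r) = past_ent P P (order_action g r)"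
    and a: "\<not> r (0, a)"
  shows "A \<in> join_algebra M T P (below r a)"
proof (rule join_algebraI_cond_ent[OF P])
  show As: "A \<in> sets M" using A by (simp add: join_algebra_def)
  have R: "finite_events M R" using As by (auto simp: R_def)
  have PR_ev: "finite_events M (P \<union> R)" using P R by auto
  \<comment> \<open>Zero past entropy at every element of the block from \<open>a\<close> to the
    unit makes the \<open>R\<close>-process on this block, in particular \<open>R\<close> itself,
    determined by its own past before \<open>a\<close>.\<close>
  have R_past: "\<exists>L. finite L \<and> L \<subseteq> below r a \<and> cond_ent M R (tr R L) \<le> e" if e: "0 < e" for e :: real
  proof -
    define K where "K = {0 :: 'g}"
    then have K: "finite K" "0 \<in> K" by simp_all
    obtain I where I: "finite I" "\<forall>h\<in>I. \<not> r (h, a)"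
      "\<forall>k\<in>K. r (k, a) \<or> k \<in> I"
      "\<forall>g\<in>I. \<forall>h. r (h, g) \<longrightarrow> r (h, a) \<or> h \<in> I"
      by (rule Z_orders_cover[OF r K(1)])
    have "0 \<in> I" using I(3)[rule_format, OF K(2)] a by simp
    obtain L where L: "finite L" "L \<subseteq> below r a"
      "\<forall>L'. finite L' \<longrightarrow> L \<subseteq> L' \<longrightarrow>
        cond_ent M (tr R I) (tr R L') \<le> (\<Sum>g\<in>I. cond_ent_on (pb R g) R (below r g)) + e"
      by (rule cond_ent_le_sum_cond_ent_on[OF r I(1) R e I(4)])
    have "R \<subseteq> tr R I"
      using pb_subset_tr[OF \<open>0 \<in> I\<close>, of R] pb_0[of R] R by simp
    then have "cond_ent M R (tr R L) \<le> cond_ent M (tr R I) (tr R L)"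
      by (intro cond_ent_mono_left tr_events[OF R] I(1) L(1))
    also have "\<dots> \<le> e"
      using L(3)[rule_format, of L] L(1) R by (simp add: cond_ent_on_below R0)
    finally show ?thesis using L(1,2) by blast
  qed
  fix e :: real assume "0 < e"
  then have e2: "0 < e / 2" "0 < e / 4" by simp_all
  obtain K where K: "finite K" "cond_ent M R (tr P K) < e / 2"
    unfolding R_def by (rule join_algebra_cond_ent_approx[OF P A e2(1)])
  obtain I where I: "finite I" "\<forall>h\<in>I. \<not> r (h, a)" "\<forall>k\<in>K. r (k, a) \<or> k \<in> I"
      "\<forall>g\<in>I. \<forall>h. r (h, g) \<longrightarrow> r (h, a) \<or> h \<in> I"
    by (rule Z_orders_cover[OF r K(1)])
  obtain L0 where L0: "finite L0" "L0 \<subseteq> below r a"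
    "\<forall>L'. finite L' \<longrightarrow> L0 \<subseteq> L' \<longrightarrow>
      cond_ent M (tr P I) (tr P L') \<le> (\<Sum>g\<in>I. cond_ent_on (pb P g) P (below r g)) + e / 4"
    by (rule cond_ent_le_sum_cond_ent_on[OF r I(1) P e2(2) I(4)])
  define L where "L = L0 \<union> (K \<inter> below r a)"
  have L: "finite L" "L \<subseteq> below r a" "L0 \<subseteq> L" "K \<subseteq> I \<union> L"
    using L0 K(1) I(3) by (auto simp: L_def below_def)
  have below_mono: "below r a \<subseteq> below r g" if "g \<in> I" for g
    using I(2)[rule_format, OF that] Z_orders_total[OF r, of a g] Z_orders_trans[OF r]
    unfolding below_def by blast
  have evL: "finite_events M (tr P L)" "finite_events M (tr P I)" "finite_events M (tr P I \<union> tr P L)"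
    using tr_events[OF P L(1)] tr_events[OF P I(1)] by auto
  \<comment> \<open>By \<open>R_past\<close> the condition \<open>R\<close> is negligible relative
    to pasts of \<open>P \<union> R\<close>; the hypothesis \<open>PR\<close> then replaces these
    pasts by those of \<open>P\<close>.\<close>
  have "(\<Sum>g\<in>I. cond_ent_on (pb P g) (P \<union> R) (below r g)) \<le> cond_ent M (tr P I) (R \<union> tr P L)"
  proof (rule sum_cond_ent_on_le_cond_ent[OF r I(1) P PR_ev Un_upper1 R L(1)])
    show "L \<subseteq> below r g" if "g \<in> I" for g using L(2) below_mono[OF that] by blast
    fix g and e :: real assume g: "g \<in> I" and "0 < e"
    then obtain J where J: "finite J" "J \<subseteq> below r a" "cond_ent M R (tr R J) \<le> e"
      using R_past[OF \<open>0 < e\<close>] by blast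
    have "cond_ent M R (tr (P \<union> R) J) \<le> cond_ent M R (tr R J)"
      by (rule cond_ent_antimono[OF R tr_events[OF PR_ev J(1)] tr_mono[OF Un_upper2 order_refl]])
    then show "\<exists>J. finite J \<and> J \<subseteq> below r g \<and> cond_ent M R (tr (P \<union> R) J) \<le> e"
      using J below_mono[OF g] by (intro exI[of _ J]) auto
  qed
  also have "(\<Sum>g\<in>I. cond_ent_on (pb P g) (P \<union> R) (below r g)) = (\<Sum>g\<in>I. cond_ent_on (pb P g) P (below r g))"
    using P PR_ev by (simp add: cond_ent_on_below PR)
  finally have lower: "cond_ent M (tr P I) (tr P L) \<le> cond_ent M (tr P I) (R \<union> tr P L) + e / 4"
    using L0(3)[rule_format, OF L(1,3)] by simp
  have "cond_ent M R (tr P I \<union> tr P L) \<le> cond_ent M R (tr P K)"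
    using L(4) by (intro cond_ent_antimono R evL) (use tr_mono[OF order_refl L(4), of P] in \<open>simp add: tr_Un\<close>)
  \<comment> \<open>Both sides are the entropy of \<open>R\<close> joined with the block given the
    past. The two block terms differ by at most \<open>e / 4\<close> and the last term is below
    \<open>e / 2\<close>.\<close>
  moreover have "cond_ent M R (tr P L) + cond_ent M (tr P I) (R \<union> tr P L)
      = cond_ent M (tr P I) (tr P L) + cond_ent M R (tr P I \<union> tr P L)"
    using cond_ent_chain[of R "tr P I" "tr P L"] cond_ent_chain[of "tr P I" R "tr P L"]
    by (simp add: Un_commute)
  ultimately have "cond_ent M R (tr P L) < e"
    using lower K(2) \<open>0 < e\<close> by simp
  then show "\<exists>K. finite K \<and> K \<subseteq> below r a \<and> cond_ent M {A, space M - A} (tr P K) < e"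
    using L(1,2) unfolding R_def by blast
qed

text \<open>All translates of \<open>R\<close> over \<open>F\<close> are determined by the P-past of
  the least element of \<open>F\<close>. Conditioning on them therefore leaves the lower bound of
  the chain rule for \<open>P\<close> intact.\<close>

lemma ent_join_ge_sum_past_ent:
  assumes r: "r \<in> Z_orders" and F: "finite F" "F \<noteq> {}" and P: "finite_events M P"
    and Z: "\<And>g. order_action g r \<in> Z_orders"
    and A: "\<And>g n. 1 \<le> n \<Longrightarrow> A \<in> join_algebra M T P (order_past (order_action g r) n)"
  defines "R \<equiv> {A, space M - A}"
  shows "ent M (tr R F) + (\<Sum>g\<in>F. past_ent P P (order_action g r)) \<le> ent M (tr (P \<union> R) F)"
proof -
  have R: "finite_events M R"
    using A[of 1 0] by (auto simp: R_def join_algebra_def)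
  obtain m where m: "m \<in> F" "\<And>x. x \<in> F \<Longrightarrow> x = m \<or> r (m, x)"
    using Z_orders_least[OF r F] by blast
  have below_mono: "below r m \<subseteq> below r g" if "g \<in> F" for g
    using m(2)[OF that] Z_orders_trans[OF r] unfolding below_def by blast
  have small: "\<exists>J. finite J \<and> J \<subseteq> below r m \<and> cond_ent M (tr R F) (tr P J) \<le> e" if "0 < e" for e :: real
  proof -
    have "0 < e / real (card F)" using that F by (simp add: card_gt_0_iff)
    have "\<exists>K. finite K \<and> (\<lambda>k. k + h) ` K \<subseteq> below r m \<and> cond_ent M R (tr P K) < e / real (card F)" for h
    \<comment> \<open>Being below \<open>m - h\<close> in the order shifted by \<open>h\<close>
      means being below \<open>m\<close> after right multiplication by \<open>h\<close>, so a
      sufficiently remote past of the shifted order is carried below \<open>m\<close>.\<close>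
    proof -
      obtain n where n: "1 \<le> n" "order_past (order_action h r) n \<subseteq> below (order_action h r) (m - h)"
        using order_past_subset_below[OF Z] by blast
      obtain K where K: "finite K" "K \<subseteq> order_past (order_action h r) n"
        "cond_ent M R (tr P K) < e / real (card F)"
        using join_algebra_cond_ent_approx[OF P A[OF n(1)] \<open>0 < e / real (card F)\<close>] unfolding R_def by blast
      have "(\<lambda>k. k + h) ` K \<subseteq> below r m"
        using K(2) n(2) by (auto simp: below_def order_action_def)
      with K show ?thesis by blast
    qed
    then obtain K where K: "\<And>h. finite (K h)" "\<And>h. (\<lambda>k. k + h) ` K h \<subseteq> below r m"
      "\<And>h. cond_ent M R (tr P (K h)) < e / real (card F)"
      by metis
    define J where "J = (\<Union>h\<in>F. (\<lambda>k. k + h) ` K h)"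
    have J: "finite J" "J \<subseteq> below r m" using F(1) K(1,2) by (auto simp: J_def)
    have evJ: "finite_events M (tr P J)" by (rule tr_events[OF P J(1)])
    have "cond_ent M (tr R F) (tr P J) \<le> (\<Sum>h\<in>F. cond_ent M (pb R h) (tr P J))"
      unfolding translates_def[of M T R F] by (intro cond_ent_UN_le F pb_events[OF R] evJ)
    also have "\<dots> \<le> (\<Sum>h\<in>F. e / real (card F))"
    proof (rule sum_mono)
      fix h assume h: "h \<in> F"
      have "cond_ent M (pb R h) (tr P J) \<le> cond_ent M (pb R h) (tr P ((\<lambda>k. k + h) ` K h))"
        using h by (intro cond_ent_antimono[OF pb_events[OF R] evJ] tr_mono) (auto simp: J_def)
      also have "\<dots> = cond_ent M R (tr P (K h))"
        unfolding pb_tr[symmetric] by (rule cond_ent_pb[OF R tr_events[OF P K(1)]])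
      finally show "cond_ent M (pb R h) (tr P J) \<le> e / real (card F)" using K(3)[of h] by simp
    qed
    also have "\<dots> = e" using F by simp
    finally show ?thesis using J by blast
  qed
  have "(\<Sum>g\<in>F. cond_ent_on (pb P g) P (below r g)) \<le> cond_ent M (tr P F) (tr R F \<union> tr P {})"
  proof (rule sum_cond_ent_on_le_cond_ent[OF r F(1) P P order_refl tr_events[OF R F(1)]])
    show "\<exists>J. finite J \<and> J \<subseteq> below r g \<and> cond_ent M (tr R F) (tr P J) \<le> e"
      if "g \<in> F" "0 < e" for g and e :: real
      using small[OF that(2)] below_mono[OF that(1)] by (meson subset_trans)
  qed auto
  then show ?thesis
    using P by (simp add: cond_ent_on_below cond_ent_def tr_Un_left)
qed

end

section \<open>Averaging over a multiorder\<close>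

locale multiordered_action = measure_preserving M T
  for M :: "'x measure" and T :: "'g::{group_add, countable} \<Rightarrow> 'x \<Rightarrow> 'x" +
  fixes N :: "'g order_rel measure"
  assumes multiorder: "multiorder N"
begin

section \<open>Measurability and invariance on the space of orders\<close>

sublocale N: prob_space N
  using multiorder by (simp add: multiorder_def pmp_action_def)

lemma sets_N: "sets N = sets (restrict_space borel Z_orders)"
  using multiorder by (simp add: multiorder_def order_algebra_def)

lemma space_N: "space N = Z_orders"
  using sets_eq_imp_space_eq[OF sets_N] by (simp add: space_restrict_space)

lemma measurable_order_action: "order_action g \<in> N \<rightarrow>\<^sub>M N"
  and distr_order_action: "distr N N (order_action g) = N"
  using multiorder by (auto simp: multiorder_def pmp_action_def)

lemma order_action_Z_orders:
  fixes r :: "'g order_rel"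
  shows "r \<in> Z_orders \<Longrightarrow> order_action g r \<in> Z_orders"
  using measurable_space[OF measurable_order_action, of r g] by (simp add: space_N)

lemma integral_order_action:
  fixes f :: "'g order_rel \<Rightarrow> real"
  assumes "f \<in> borel_measurable N"
  shows "(\<integral>r. f (order_action g r) \<partial>N) = (\<integral>r. f r \<partial>N)"
  using integral_distr[OF measurable_order_action[of g] assms] by (simp add: distr_order_action)

text \<open>Each translate preserves null sets, and \<open>G\<close> is countable.\<close>

lemma AE_order_action:
  assumes "AE r in N. Q r"
  shows "AE r in N. \<forall>g. Q (order_action g r)"
proof -
  have "AE r in N. Q (order_action g r)" for g
    by (rule AE_distrD[OF measurable_order_action[of g]]) (unfold distr_order_action, fact assms)
  then show ?thesis by (simp add: AE_all_countable)
qed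

lemma sets_order_coordinate: "{r \<in> space N. r p} \<in> sets N"
proof -
  have "open {True}" by (rule discrete_topology_class.open_discrete)
  then have "open ((\<lambda>r :: 'g order_rel. r p) -` {True})"
    by (intro open_vimage continuous_on_product_coordinates)
  then have "(\<lambda>r :: 'g order_rel. r p) -` {True} \<in> sets borel" by (rule borel_open)
  moreover have "{r \<in> space N. r p} = Z_orders \<inter> ((\<lambda>r. r p) -` {True})"
    by (auto simp: space_N)
  ultimately show ?thesis unfolding sets_N sets_restrict_space by blast
qed

text \<open>The set \<open>K \<inter> below r 0\<close> has finitely many possible values, each
  decided by the finitely many coordinates \<open>r (k, 0)\<close>.\<close>

lemma measurable_finite_below:
  fixes \<phi> :: "'g set \<Rightarrow> real"
  assumes K: "finite K"
  shows "(\<lambda>r. \<phi> (K \<inter> below r 0)) \<in> borel_measurable N"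
proof (rule measurable_compose[of "\<lambda>r. K \<inter> below r 0" N "count_space (Pow K)"])
  have "(\<lambda>r. K \<inter> below r 0) -` {S} \<inter> space N \<in> sets N" if "S \<subseteq> K" for S
  proof -
    have coord: "{r \<in> space N. r (k, 0) \<longleftrightarrow> k \<in> S} \<in> sets N" for k
    proof (cases "k \<in> S")
      case True
      then show ?thesis using sets_order_coordinate[of "(k, 0)"] by simp
    next
      case False
      then have "{r \<in> space N. r (k, 0) \<longleftrightarrow> k \<in> S} = space N - {r \<in> space N. r (k, 0)}" by blast
      then show ?thesis using sets.compl_sets[OF sets_order_coordinate[of "(k, 0)"]] by simp
    qed
    have "(\<lambda>r. K \<inter> below r 0) -` {S} \<inter> space N = {r \<in> space N. \<forall>k\<in>K. r (k, 0) \<longleftrightarrow> k \<in> S}"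
      using that unfolding below_def by blast
    also have "\<dots> \<in> sets N"
      by (rule sets.sets_Collect_finite_All[OF coord K])
    finally show ?thesis .
  qed
  then show "(\<lambda>r. K \<inter> below r 0) \<in> N \<rightarrow>\<^sub>M count_space (Pow K)"
    using K by (simp add: measurable_count_space_eq2)
qed simp

lemma past_ent_measurable:
  assumes "finite_events M Q" "finite_events M C"
  shows "past_ent Q C \<in> borel_measurable N"
proof (rule borel_measurable_LIMSEQ_real)
  show "(\<lambda>n. cond_ent M Q (tr C (window n \<inter> below r 0))) \<longlonglongrightarrow> past_ent Q C r" for r
    unfolding past_ent_def by (rule cond_ent_on_tendsto[OF assms])
  show "(\<lambda>r. cond_ent M Q (tr C (window n \<inter> below r 0))) \<in> borel_measurable N" for n
    by (rule measurable_finite_below[OF finite_window])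
qed

lemma past_ent_integrable:
  assumes "finite_events M Q" "finite_events M C"
  shows "integrable N (past_ent Q C)"
proof (rule N.integrable_const_bound)
  show "AE r in N. norm (past_ent Q C r) \<le> ent M Q"
    using past_ent_nonneg[OF assms] past_ent_le[OF assms] by simp
qed (rule past_ent_measurable[OF assms])

lemma past_ent_action_integrable:
  assumes "finite_events M Q" "finite_events M C"
  shows "integrable N (\<lambda>r. past_ent Q C (order_action g r))"
proof (rule N.integrable_const_bound)
  show "AE r in N. norm (past_ent Q C (order_action g r)) \<le> ent M Q"
    using past_ent_nonneg[OF assms] past_ent_le[OF assms] by simp
qed (rule measurable_compose[OF measurable_order_action past_ent_measurable[OF assms]])

text \<open>For \<open>Q = C\<close> this is the candidate for the entropy of the process generated
  by \<open>C\<close>.\<close>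

definition mean_past_ent :: "'x set set \<Rightarrow> 'x set set \<Rightarrow> real" where
  "mean_past_ent Q C = (\<integral>r. past_ent Q C r \<partial>N)"

section \<open>Dynamical entropy as a mean over orders\<close>

lemma mean_past_ent_nonneg:
  "finite_events M Q \<Longrightarrow> finite_events M C \<Longrightarrow> 0 \<le> mean_past_ent Q C"
  unfolding mean_past_ent_def by (intro integral_nonneg_AE) (simp add: past_ent_nonneg)

lemma integral_sum_past_ent:
  assumes "finite_events M Q" "finite_events M C"
  shows "(\<integral>r. (\<Sum>g\<in>F. past_ent Q C (order_action g r)) \<partial>N) = real (card F) * mean_past_ent Q C"
  using assms
  by (simp add: Bochner_Integration.integral_sum past_ent_action_integrable integral_order_action
      past_ent_measurable mean_past_ent_def)

lemma mean_past_ent_le_ent: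
  assumes F: "finite F" and C: "finite_events M C"
  shows "real (card F) * mean_past_ent C C \<le> ent M (tr C F)"
proof -
  have "(\<integral>r. (\<Sum>g\<in>F. past_ent C C (order_action g r)) \<partial>N) \<le> (\<integral>r. ent M (tr C F) \<partial>N)"
  proof (rule integral_mono)
    show "integrable N (\<lambda>r. \<Sum>g\<in>F. past_ent C C (order_action g r))"
      by (intro Bochner_Integration.integrable_sum past_ent_action_integrable C)
    show "(\<Sum>g\<in>F. past_ent C C (order_action g r)) \<le> ent M (tr C F)" if "r \<in> space N" for r
      using that by (intro sum_past_ent_le_ent F C) (simp add: space_N)
  qed simp
  then show ?thesis by (simp add: integral_sum_past_ent[OF C C] N.prob_space)
qed

lemma ent_le_mean_window:
  assumes F: "finite F" and K: "finite K" and C: "finite_events M C"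
  shows "ent M (tr C F) \<le> real (card F) * (\<integral>r. cond_ent M C (tr C (K \<inter> below r 0)) \<partial>N)
    + real (card {g \<in> F. \<not> (\<lambda>k. k + g) ` K \<subseteq> F}) * ent M C"
proof -
  let ?f = "\<lambda>r. cond_ent M C (tr C (K \<inter> below r 0))"
  let ?b = "real (card {g \<in> F. \<not> (\<lambda>k. k + g) ` K \<subseteq> F}) * ent M C"
  have meas: "?f \<in> borel_measurable N" by (rule measurable_finite_below[OF K])
  have int: "integrable N (\<lambda>r. ?f (order_action g r))" for g
  proof (rule N.integrable_const_bound)
    have ev: "finite_events M (tr C (K \<inter> S))" for S
      by (rule tr_events[OF C]) (simp add: K)
    show "AE r in N. norm (?f (order_action g r)) \<le> ent M C"
      using cond_ent_nonneg[OF C ev] cond_ent_le_ent[OF C ev] by simp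
  qed (rule measurable_compose[OF measurable_order_action meas])
  then have int_sum: "integrable N (\<lambda>r. \<Sum>g\<in>F. ?f (order_action g r))"
    by (rule Bochner_Integration.integrable_sum)
  have "(\<integral>r. ent M (tr C F) \<partial>N) \<le> (\<integral>r. (\<Sum>g\<in>F. ?f (order_action g r)) + ?b \<partial>N)"
  proof (rule integral_mono)
    show "integrable N (\<lambda>r. (\<Sum>g\<in>F. ?f (order_action g r)) + ?b)"
      by (intro Bochner_Integration.integrable_add int_sum) simp
    show "ent M (tr C F) \<le> (\<Sum>g\<in>F. ?f (order_action g r)) + ?b" if "r \<in> space N" for r
      using that by (intro ent_le_sum_window F K C) (simp add: space_N)
  qed simp
  also have "\<dots> = (\<integral>r. (\<Sum>g\<in>F. ?f (order_action g r)) \<partial>N) + ?b"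
    using int_sum by (simp add: N.prob_space)
  also have "(\<integral>r. (\<Sum>g\<in>F. ?f (order_action g r)) \<partial>N) = (\<Sum>g\<in>F. \<integral>r. ?f (order_action g r) \<partial>N)"
    using int by (intro Bochner_Integration.integral_sum)
  also have "\<dots> = real (card F) * (\<integral>r. ?f r \<partial>N)"
    by (simp add: integral_order_action[OF meas])
  finally show ?thesis by (simp add: N.prob_space)
qed

text \<open>The lower bound holds for every finite nonempty set. For the upper bound, the past is
  cut to a window whose mean entropy is nearly optimal, and the boundary term vanishes along the
  Folner sequence.\<close>

lemma folner_entropy:
  assumes F: "folner_sequence F" and C: "finite_events M C"
  shows "(\<lambda>n. ent M (tr C (F n)) / real (card (F n))) \<longlonglongrightarrow> mean_past_ent C C"
proof (rule order_tendstoI)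
  have fin: "finite (F n)" for n using F by (simp add: folner_sequence_def)
  fix y assume y: "y < mean_past_ent C C"
  show "eventually (\<lambda>n. y < ent M (tr C (F n)) / real (card (F n))) sequentially"
    using folner_eventually_nonempty[OF F]
  proof eventually_elim
    fix n assume "F n \<noteq> {}"
    then have "0 < real (card (F n))" using fin[of n] by (simp add: card_gt_0_iff)
    moreover have "real (card (F n)) * mean_past_ent C C \<le> ent M (tr C (F n))"
      by (rule mean_past_ent_le_ent[OF fin C])
    ultimately have "mean_past_ent C C \<le> ent M (tr C (F n)) / real (card (F n))"
      by (simp add: le_divide_eq mult.commute)
    with y show "y < ent M (tr C (F n)) / real (card (F n))" by simp
  qed
next
  have fin: "finite (F n)" for n using F by (simp add: folner_sequence_def)
  fix y assume y: "mean_past_ent C C < y"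
  let ?I = "\<lambda>m. \<integral>r. cond_ent M C (tr C (window m \<inter> below r 0)) \<partial>N"
  \<comment> \<open>The integrands converge at every order and lie between 0 and
    \<open>ent M C\<close>.\<close>
  have "?I \<longlonglongrightarrow> mean_past_ent C C"
    unfolding mean_past_ent_def
  proof (rule integral_dominated_convergence)
    have ev: "finite_events M (tr C (window m \<inter> S))" for m S
      by (rule tr_events[OF C]) (simp add: finite_window)
    show "AE r in N. norm (cond_ent M C (tr C (window m \<inter> below r 0))) \<le> ent M C" for m
      using cond_ent_nonneg[OF C ev] cond_ent_le_ent[OF C ev] by simp
    show "AE r in N. (\<lambda>m. cond_ent M C (tr C (window m \<inter> below r 0))) \<longlonglongrightarrow> past_ent C C r"
      unfolding past_ent_def using cond_ent_on_tendsto[OF C C] by simp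
    show "(\<lambda>r. cond_ent M C (tr C (window m \<inter> below r 0))) \<in> borel_measurable N" for m
      by (rule measurable_finite_below[OF finite_window])
  qed (simp_all add: past_ent_measurable C)
  then have "eventually (\<lambda>m. ?I m < y) sequentially"
    using y by (rule order_tendstoD)
  then obtain m where m: "?I m < y" by (auto simp: eventually_sequentially)
  let ?b = "\<lambda>n. real (card {g \<in> F n. \<not> (\<lambda>k. k + g) ` window m \<subseteq> F n}) / real (card (F n))"
  have "(\<lambda>n. ?I m + ?b n * ent M C) \<longlonglongrightarrow> ?I m + 0 * ent M C"
    by (intro tendsto_intros folner_boundary F finite_window)
  then have "eventually (\<lambda>n. ?I m + ?b n * ent M C < y) sequentially"
    by (rule order_tendstoD) (use m in simp)
  then show "eventually (\<lambda>n. ent M (tr C (F n)) / real (card (F n)) < y) sequentially"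
    using folner_eventually_nonempty[OF F]
  proof eventually_elim
    fix n assume n: "?I m + ?b n * ent M C < y" and "F n \<noteq> {}"
    then have pos: "0 < real (card (F n))" using fin[of n] by (simp add: card_gt_0_iff)
    have "ent M (tr C (F n)) \<le> real (card (F n)) * ?I m
        + real (card {g \<in> F n. \<not> (\<lambda>k. k + g) ` window m \<subseteq> F n}) * ent M C"
      by (rule ent_le_mean_window[OF fin finite_window C])
    then have "ent M (tr C (F n)) / real (card (F n)) \<le> (real (card (F n)) * ?I m
        + real (card {g \<in> F n. \<not> (\<lambda>k. k + g) ` window m \<subseteq> F n}) * ent M C) / real (card (F n))"
      using pos by (intro divide_right_mono) auto
    also have "\<dots> = ?I m + ?b n * ent M C"
      using pos by (simp add: add_divide_distrib)
    finally show "ent M (tr C (F n)) / real (card (F n)) < y" using n by simp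
  qed
qed

text \<open>All Folner sequences share this limit, and amenability supplies at least one, without
  which the description in \<open>dyn_entropy\<close> would not single out a number.\<close>

lemma dyn_entropy_eq:
  assumes am: "amenable_group TYPE('g)" and R: "finite_events M R" "disjoint R" "\<Union>R = space M"
  shows "dyn_entropy M T R = mean_past_ent R R"
proof -
  have lim: "(\<lambda>n. partition_entropy M (join_partition M T R (F n)) / real (card (F n))) \<longlonglongrightarrow> mean_past_ent R R"
    if F: "folner_sequence F" for F
  proof (rule Lim_transform_eventually[OF folner_entropy[OF F R(1)]])
    show "eventually (\<lambda>n. ent M (tr R (F n)) / real (card (F n))
        = partition_entropy M (join_partition M T R (F n)) / real (card (F n))) sequentially"
      using folner_eventually_nonempty[OF F]
      by eventually_elim (simp add: partition_entropy_join_partition R)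
  qed
  obtain F :: "nat \<Rightarrow> 'g set" where F: "folner_sequence F"
    using am unfolding amenable_group_def by blast
  show ?thesis
    unfolding dyn_entropy_def
  proof (rule the_equality)
    fix h assume "\<forall>F. folner_sequence F \<longrightarrow>
      (\<lambda>n. partition_entropy M (join_partition M T R (F n)) / real (card (F n))) \<longlonglongrightarrow> h"
    with F have "(\<lambda>n. partition_entropy M (join_partition M T R (F n)) / real (card (F n))) \<longlonglongrightarrow> h"
      by blast
    then show "h = mean_past_ent R R" by (rule LIMSEQ_unique[OF _ lim[OF F]])
  qed (use lim in blast)
qed

section \<open>Entropy of a join with an event\<close>

lemma mean_past_ent_mono:
  assumes am: "amenable_group TYPE('g)" and D: "finite_events M D" and CD: "C \<subseteq> D"
  shows "mean_past_ent C C \<le> mean_past_ent D D"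
proof -
  obtain F :: "nat \<Rightarrow> 'g set" where F: "folner_sequence F"
    using am unfolding amenable_group_def by blast
  have fin: "finite (F n)" for n using F by (simp add: folner_sequence_def)
  have C: "finite_events M C" using D CD by (auto intro: finite_subset)
  have "ent M (tr C (F n)) / real (card (F n)) \<le> ent M (tr D (F n)) / real (card (F n))" for n
    by (intro divide_right_mono ent_mono tr_events[OF D fin] tr_mono CD order_refl) simp
  then show ?thesis
    by (intro LIMSEQ_le[OF folner_entropy[OF F C] folner_entropy[OF F D]]) blast
qed

text \<open>An event of \<open>P\<^sup>G\<close> has entropy below \<open>e\<close> given finitely
  many translates of \<open>P\<close>, so joining it adds at most \<open>e\<close> per element of
  the Folner set, plus a boundary term.\<close>

lemma mean_past_ent_join_le:
  assumes am: "amenable_group TYPE('g)" and P: "finite_events M P"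
    and A: "A \<in> join_algebra M T P UNIV"
  defines "R \<equiv> {A, space M - A}"
  shows "mean_past_ent (P \<union> R) (P \<union> R) \<le> mean_past_ent P P"
proof (rule field_le_epsilon)
  fix e :: real assume "0 < e"
  have R: "finite_events M R" using A by (auto simp: R_def join_algebra_def)
  have PR: "finite_events M (P \<union> R)" using P R by auto
  obtain F :: "nat \<Rightarrow> 'g set" where F: "folner_sequence F"
    using am unfolding amenable_group_def by blast
  have fin: "finite (F n)" for n using F by (simp add: folner_sequence_def)
  obtain K where K: "finite K" "cond_ent M R (tr P K) < e"
    unfolding R_def by (rule join_algebra_cond_ent_approx[OF P A \<open>0 < e\<close>])
  let ?b = "\<lambda>n. real (card {g \<in> F n. \<not> (\<lambda>k. k + g) ` K \<subseteq> F n}) / real (card (F n))"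
  have lim: "(\<lambda>n. ent M (tr P (F n)) / real (card (F n)) + e + ?b n * ent M R)
      \<longlonglongrightarrow> mean_past_ent P P + e + 0 * ent M R"
    by (intro tendsto_intros folner_entropy folner_boundary F P K)
  have "eventually (\<lambda>n. ent M (tr (P \<union> R) (F n)) / real (card (F n))
      \<le> ent M (tr P (F n)) / real (card (F n)) + e + ?b n * ent M R) sequentially"
    using folner_eventually_nonempty[OF F]
  proof eventually_elim
    fix n assume "F n \<noteq> {}"
    then have pos: "0 < real (card (F n))" using fin[of n] by (simp add: card_gt_0_iff)
    have "ent M (tr (P \<union> R) (F n)) / real (card (F n)) \<le> (ent M (tr P (F n)) + real (card (F n)) * e
        + real (card {g \<in> F n. \<not> (\<lambda>k. k + g) ` K \<subseteq> F n}) * ent M R) / real (card (F n))"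
      using K(2) by (intro divide_right_mono ent_tr_join_le[OF fin K(1) P R]) auto
    also have "\<dots> = ent M (tr P (F n)) / real (card (F n)) + e + ?b n * ent M R"
      using pos by (simp add: add_divide_distrib)
    finally show "ent M (tr (P \<union> R) (F n)) / real (card (F n))
      \<le> ent M (tr P (F n)) / real (card (F n)) + e + ?b n * ent M R" .
  qed
  then show "mean_past_ent (P \<union> R) (P \<union> R) \<le> mean_past_ent P P + e"
    using tendsto_le[OF sequentially_bot lim folner_entropy[OF F PR]] by simp
qed

text \<open>Turns zero entropy into the two pointwise hypotheses of
  \<open>mem_join_algebra_below\<close>. Each comes from a nonnegative function of the order with
  zero integral, and invariance extends it to all translates of almost every order.\<close>

lemma zero_entropy_AE:
  assumes am: "amenable_group TYPE('g)" and P: "finite_events M P"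
    and A: "A \<in> join_algebra M T P UNIV"
  defines "R \<equiv> {A, space M - A}"
  assumes zero: "mean_past_ent R R = 0"
  shows "AE r in N. \<forall>n\<ge>1. A \<in> join_algebra M T P (order_past r n)"
proof -
  have R: "finite_events M R" using A by (auto simp: R_def join_algebra_def)
  have PR: "finite_events M (P \<union> R)" using P R by auto
  have "AE r in N. past_ent R R r = 0"
    using zero integral_nonneg_eq_0_iff_AE[OF past_ent_integrable[OF R R]]
    by (simp add: mean_past_ent_def past_ent_nonneg[OF R R])
  then have R0: "AE r in N. \<forall>g. past_ent R R (order_action g r) = 0"
    by (rule AE_order_action)
  have "mean_past_ent P P \<le> mean_past_ent (P \<union> R) (P \<union> R)"
    by (rule mean_past_ent_mono[OF am PR Un_upper1])
  also have "\<dots> \<le> (\<integral>r. past_ent P (P \<union> R) r + past_ent R R r \<partial>N)"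
    unfolding mean_past_ent_def
  proof (rule integral_mono)
    \<comment> \<open>Subadditivity, followed by shrinking the condition of the second term from
      \<open>P \<union> R\<close> to \<open>R\<close>; that term has mean zero.\<close>
    show "past_ent (P \<union> R) (P \<union> R) r \<le> past_ent P (P \<union> R) r + past_ent R R r" for r
      using cond_ent_on_subadd[OF P R PR, of "below r 0"] cond_ent_on_antimono[OF R PR Un_upper2, of "below r 0"]
      by (simp add: past_ent_def)
  qed (intro Bochner_Integration.integrable_add past_ent_integrable P R PR)+
  also have "\<dots> = mean_past_ent P (P \<union> R)"
    using zero by (simp add: mean_past_ent_def past_ent_integrable[OF P PR] past_ent_integrable[OF R R])
  finally have le: "mean_past_ent P P \<le> mean_past_ent P (P \<union> R)" .
  have mono: "past_ent P (P \<union> R) r \<le> past_ent P P r" for r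
    unfolding past_ent_def by (rule cond_ent_on_antimono[OF P PR Un_upper1])
  let ?d = "\<lambda>r. past_ent P P r - past_ent P (P \<union> R) r"
  have int: "integrable N ?d"
    by (intro Bochner_Integration.integrable_diff past_ent_integrable P PR)
  have "(\<integral>r. ?d r \<partial>N) = mean_past_ent P P - mean_past_ent P (P \<union> R)"
    unfolding mean_past_ent_def by (intro Bochner_Integration.integral_diff past_ent_integrable P PR)
  moreover have "0 \<le> (\<integral>r. ?d r \<partial>N)"
    by (intro integral_nonneg_AE) (simp add: mono)
  ultimately have "(\<integral>r. ?d r \<partial>N) = 0" using le by simp
  then have "AE r in N. ?d r = 0"
    using integral_nonneg_eq_0_iff_AE[OF int] by (simp add: mono)
  then have "AE r in N. past_ent P (P \<union> R) r = past_ent P P r"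
    by eventually_elim simp
  then have "AE r in N. \<forall>g. past_ent P (P \<union> R) (order_action g r) = past_ent P P (order_action g r)"
    by (rule AE_order_action)
  with R0 AE_space show ?thesis
  proof eventually_elim
    fix r assume *: "\<forall>g. past_ent R R (order_action g r) = 0" "r \<in> space N"
      "\<forall>g. past_ent P (P \<union> R) (order_action g r) = past_ent P P (order_action g r)"
    have r: "r \<in> Z_orders" using *(2) by (simp add: space_N)
    show "\<forall>n\<ge>1. A \<in> join_algebra M T P (order_past r n)"
    proof (intro allI impI)
      fix n :: nat assume "1 \<le> n"
      obtain a where a: "\<not> r (0, a)" "order_past r n = below r a"
        by (rule order_past_below_origin[OF r \<open>1 \<le> n\<close>])
      show "A \<in> join_algebra M T P (order_past r n)"
        unfolding a(2) using * a(1)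
        by (intro mem_join_algebra_below[OF r P A]) (simp_all add: R_def)
    qed
  qed
qed

text \<open>The differences are nonnegative, so their L1 norms are their means, which tend to zero
  by \<open>folner_entropy\<close>. Convergence in L1 gives almost sure convergence along a
  subsequence that depends on \<open>P\<close> and \<open>F\<close> but on no event
  \<open>A\<close>.\<close>

lemma AE_entropy_subsequence:
  assumes F: "folner_sequence F" and P: "finite_events M P"
  obtains s where "strict_mono s"
    "AE r in N. (\<lambda>n. (ent M (tr P (F (s n))) - (\<Sum>g\<in>F (s n). past_ent P P (order_action g r)))
      / real (card (F (s n)))) \<longlonglongrightarrow> 0"
proof -
  have fin: "finite (F n)" for n using F by (simp add: folner_sequence_def)
  define u where "u n r = (ent M (tr P (F n)) - (\<Sum>g\<in>F n. past_ent P P (order_action g r))) / real (card (F n))"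
    for n r
  have int: "integrable N (u n)" for n
    unfolding u_def
    by (intro integrable_divide Bochner_Integration.integrable_diff Bochner_Integration.integrable_sum
        past_ent_action_integrable P) simp_all
  have norm_eq: "(\<integral>r. norm (u n r) \<partial>N)
      = ent M (tr P (F n)) / real (card (F n)) - real (card (F n)) * mean_past_ent P P / real (card (F n))" for n
  proof -
    have "(\<integral>r. norm (u n r) \<partial>N) = (\<integral>r. u n r \<partial>N)"
    proof (rule Bochner_Integration.integral_cong[OF refl])
      fix r assume "r \<in> space N"
      then have "0 \<le> u n r"
        using sum_past_ent_le_ent[OF _ fin P, of r n] by (simp add: u_def space_N)
      then show "norm (u n r) = u n r" by simp
    qed
    also have "\<dots> = ((\<integral>r. ent M (tr P (F n)) - (\<Sum>g\<in>F n. past_ent P P (order_action g r)) \<partial>N)) / real (card (F n))"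
      unfolding u_def by simp
    also have "(\<integral>r. ent M (tr P (F n)) - (\<Sum>g\<in>F n. past_ent P P (order_action g r)) \<partial>N)
        = ent M (tr P (F n)) - real (card (F n)) * mean_past_ent P P"
      by (subst Bochner_Integration.integral_diff)
        (simp_all add: integral_sum_past_ent[OF P P] N.prob_space
          Bochner_Integration.integrable_sum past_ent_action_integrable[OF P P])
    finally show ?thesis by (simp add: diff_divide_distrib)
  qed
  have "(\<lambda>n. ent M (tr P (F n)) / real (card (F n)) - mean_past_ent P P) \<longlonglongrightarrow> mean_past_ent P P - mean_past_ent P P"
    by (intro tendsto_diff folner_entropy F P tendsto_const)
  then have "(\<lambda>n. \<integral>r. norm (u n r) \<partial>N) \<longlonglongrightarrow> mean_past_ent P P - mean_past_ent P P"
  proof (rule Lim_transform_eventually)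
    show "eventually (\<lambda>n. ent M (tr P (F n)) / real (card (F n)) - mean_past_ent P P
        = (\<integral>r. norm (u n r) \<partial>N)) sequentially"
      using folner_eventually_nonempty[OF F]
    proof eventually_elim
      fix n assume "F n \<noteq> {}"
      then have "real (card (F n)) \<noteq> 0" using fin[of n] by simp
      then show "ent M (tr P (F n)) / real (card (F n)) - mean_past_ent P P = (\<integral>r. norm (u n r) \<partial>N)"
        unfolding norm_eq by simp
    qed
  qed
  then obtain s where "strict_mono s" "AE r in N. (\<lambda>n. u (s n) r) \<longlonglongrightarrow> 0"
    using tendsto_L1_AE_subseq[of N u, OF int] by auto
  then show thesis by (intro that) (simp_all add: u_def)
qed

text \<open>Divide \<open>ent_join_ge_sum_past_ent\<close> by the size of the Folner set and pass to
  the limit along \<open>s\<close>: the entropies of \<open>R\<close> and \<open>P\<close> add up to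
  at most that of their join, which \<open>mean_past_ent_join_le\<close> bounds by that of
  \<open>P\<close>.\<close>

lemma remote_past_zero_entropy:
  assumes am: "amenable_group TYPE('g)" and F: "folner_sequence F" and P: "finite_events M P"
    and s: "strict_mono s" and r: "r \<in> Z_orders"
    and lim: "(\<lambda>n. (ent M (tr P (F (s n))) - (\<Sum>g\<in>F (s n). past_ent P P (order_action g r)))
      / real (card (F (s n)))) \<longlonglongrightarrow> 0"
    and A: "\<And>g n. 1 \<le> n \<Longrightarrow> A \<in> join_algebra M T P (order_past (order_action g r) n)"
  defines "R \<equiv> {A, space M - A}"
  shows "mean_past_ent R R = 0"
proof -
  have A_UNIV: "A \<in> join_algebra M T P UNIV"
    using A[of 1 0] join_algebra_mono[OF subset_UNIV] by blast
  have R: "finite_events M R" using A_UNIV by (auto simp: R_def join_algebra_def)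
  have PR: "finite_events M (P \<union> R)" using P R by auto
  have fin: "finite (F n)" for n using F by (simp add: folner_sequence_def)
  let ?q = "\<lambda>C n. ent M (tr C (F (s n))) / real (card (F (s n)))"
  have q: "?q C \<longlonglongrightarrow> mean_past_ent C C" if "finite_events M C" for C
    using LIMSEQ_subseq_LIMSEQ[OF folner_entropy[OF F that] s] by (simp add: o_def)
  let ?d = "\<lambda>n. (ent M (tr P (F (s n))) - (\<Sum>g\<in>F (s n). past_ent P P (order_action g r)))
      / real (card (F (s n)))"
  have "(\<lambda>n. ?q (P \<union> R) n + ?d n) \<longlonglongrightarrow> mean_past_ent (P \<union> R) (P \<union> R) + 0"
    by (intro tendsto_add q PR lim)
  moreover have "(\<lambda>n. ?q R n + ?q P n) \<longlonglongrightarrow> mean_past_ent R R + mean_past_ent P P"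
    by (intro tendsto_add q R P)
  moreover have "eventually (\<lambda>n. ?q R n + ?q P n \<le> ?q (P \<union> R) n + ?d n) sequentially"
    using eventually_subseq[OF s folner_eventually_nonempty[OF F]]
  proof eventually_elim
    fix n assume ne: "F (s n) \<noteq> {}"
    have "ent M (tr R (F (s n))) + (\<Sum>g\<in>F (s n). past_ent P P (order_action g r))
        \<le> ent M (tr (P \<union> R) (F (s n)))"
      unfolding R_def by (rule ent_join_ge_sum_past_ent[OF r fin ne P order_action_Z_orders[OF r] A])
    then have "ent M (tr R (F (s n))) + ent M (tr P (F (s n))) \<le> ent M (tr (P \<union> R) (F (s n)))
        + (ent M (tr P (F (s n))) - (\<Sum>g\<in>F (s n). past_ent P P (order_action g r)))"
      by simp
    then show "?q R n + ?q P n \<le> ?q (P \<union> R) n + ?d n"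
      unfolding add_divide_distrib[symmetric] by (rule divide_right_mono) simp
  qed
  ultimately have "mean_past_ent R R + mean_past_ent P P \<le> mean_past_ent (P \<union> R) (P \<union> R) + 0"
    by (intro tendsto_le[OF sequentially_bot])
  moreover have "mean_past_ent (P \<union> R) (P \<union> R) \<le> mean_past_ent P P"
    unfolding R_def by (rule mean_past_ent_join_le[OF am P A_UNIV])
  ultimately show ?thesis using mean_past_ent_nonneg[OF R R] by simp
qed

section \<open>The Pinsker sigma-algebra and the remote past\<close>

lemma dyn_entropy_event:
  assumes "amenable_group TYPE('g)" and A: "A \<in> sets M"
  shows "dyn_entropy M T {A, space M - A} = mean_past_ent {A, space M - A} {A, space M - A}"
  using sets.sets_into_space[OF A] A
  by (intro dyn_entropy_eq assms) (auto simp: disjoint_def)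

text \<open>In \<open>zero_entropy_AE\<close> the exceptional null set depends on \<open>A\<close>.
  A countable dense part of the Pinsker algebra yields a common null set, and each
  \<open>P\<^sup>D\<close> is closed under approximation in measure.\<close>

lemma pinsker_subset_AE:
  assumes am: "amenable_group TYPE('g)" and P: "finite_events M P"
  shows "AE r in N. \<forall>A\<in>pinsker_algebra M T P. \<forall>n\<ge>1. A \<in> join_algebra M T P (order_past r n)"
proof -
  let ?S = "pinsker_algebra M T P"
  have S: "?S \<subseteq> join_algebra M T P UNIV" by (auto simp: pinsker_algebra_def)
  obtain S' where S': "countable S'" "S' \<subseteq> ?S"
    "\<And>A e::real. A \<in> ?S \<Longrightarrow> 0 < e \<Longrightarrow> \<exists>A'\<in>S'. prob (sym_diff A A') < e"
    using join_algebra_countable_dense[OF P S] by metis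
  have "AE r in N. \<forall>n\<ge>1. A \<in> join_algebra M T P (order_past r n)" if "A \<in> ?S" for A
  proof (rule zero_entropy_AE[OF am P])
    show A: "A \<in> join_algebra M T P UNIV" using S that by blast
    then have "A \<in> sets M" by (simp add: join_algebra_def)
    then show "mean_past_ent {A, space M - A} {A, space M - A} = 0"
      using that by (simp add: pinsker_algebra_def flip: dyn_entropy_event[OF am])
  qed
  then have "AE r in N. \<forall>A\<in>S'. \<forall>n\<ge>1. A \<in> join_algebra M T P (order_past r n)"
    using S'(2) by (subst AE_ball_countable[OF S'(1)]) blast
  then show ?thesis
  proof eventually_elim
    fix r assume r: "\<forall>A\<in>S'. \<forall>n\<ge>1. A \<in> join_algebra M T P (order_past r n)"
    show "\<forall>A\<in>?S. \<forall>n\<ge>1. A \<in> join_algebra M T P (order_past r n)"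
    proof (intro ballI allI impI)
      fix A and n :: nat assume A: "A \<in> ?S" and n: "1 \<le> n"
      show "A \<in> join_algebra M T P (order_past r n)"
      proof (rule join_algebra_closed)
        show "A \<in> sets M" using S A by (auto simp: join_algebra_def)
        fix e :: real assume "0 < e"
        then obtain A' where "A' \<in> S'" "prob (sym_diff A A') < e" using S'(3)[OF A] by blast
        then show "\<exists>A'\<in>join_algebra M T P (order_past r n). prob (sym_diff A A') < e"
          using r n by blast
      qed (use P in simp)
    qed
  qed
qed

text \<open>One inclusion is \<open>pinsker_subset_AE\<close> at all translates of the order. The
  other is \<open>remote_past_zero_entropy\<close>, valid for every event at once because the
  subsequence is fixed beforehand.\<close>

lemma pinsker_eq_AE:
  assumes am: "amenable_group TYPE('g)" and P: "finite_events M P"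
  shows "AE r in N. pinsker_algebra M T P =
    (\<Inter>g. \<Inter>n\<in>{1..}. join_algebra M T P (order_past (order_action g r) n))"
proof -
  obtain F :: "nat \<Rightarrow> 'g set" where F: "folner_sequence F"
    using am unfolding amenable_group_def by blast
  obtain s where s: "strict_mono s"
    "AE r in N. (\<lambda>n. (ent M (tr P (F (s n))) - (\<Sum>g\<in>F (s n). past_ent P P (order_action g r)))
      / real (card (F (s n)))) \<longlonglongrightarrow> 0"
    by (rule AE_entropy_subsequence[OF F P])
  from s(2) AE_order_action[OF pinsker_subset_AE[OF am P]] AE_space show ?thesis
  proof eventually_elim
    fix r assume lim: "(\<lambda>n. (ent M (tr P (F (s n))) - (\<Sum>g\<in>F (s n). past_ent P P (order_action g r)))
        / real (card (F (s n)))) \<longlonglongrightarrow> 0"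
      and sub: "\<forall>g. \<forall>A\<in>pinsker_algebra M T P. \<forall>n\<ge>1. A \<in> join_algebra M T P (order_past (order_action g r) n)"
      and "r \<in> space N"
    have r: "r \<in> Z_orders" using \<open>r \<in> space N\<close> by (simp add: space_N)
    show "pinsker_algebra M T P =
      (\<Inter>g. \<Inter>n\<in>{1..}. join_algebra M T P (order_past (order_action g r) n))"
    proof (intro equalityI subsetI)
      fix A assume "A \<in> (\<Inter>g. \<Inter>n\<in>{1..}. join_algebra M T P (order_past (order_action g r) n))"
      then have A: "A \<in> join_algebra M T P (order_past (order_action g r) n)" if "1 \<le> n" for g n
        using that by auto
      have A_UNIV: "A \<in> join_algebra M T P UNIV"
        using A[of 1 0] join_algebra_mono[OF subset_UNIV] by blast
      then have "A \<in> sets M" by (simp add: join_algebra_def)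
      then have "dyn_entropy M T {A, space M - A} = 0"
        using remote_past_zero_entropy[OF am F P s(1) r lim A] by (simp add: dyn_entropy_event[OF am])
      with A_UNIV show "A \<in> pinsker_algebra M T P" by (simp add: pinsker_algebra_def)
    qed (use sub in auto)
  qed
qed

lemma mem_pinsker_iff_AE:
  assumes am: "amenable_group TYPE('g)" and P: "finite_events M P"
  shows "A \<in> pinsker_algebra M T P \<longleftrightarrow>
    (AE r in N. A \<in> (\<Inter>n\<in>{1..}. join_algebra M T P (order_past r n)))"
proof
  assume A: "A \<in> pinsker_algebra M T P"
  from pinsker_subset_AE[OF am P]
  show "AE r in N. A \<in> (\<Inter>n\<in>{1..}. join_algebra M T P (order_past r n))"
    by eventually_elim (use A in auto)
next
  assume "AE r in N. A \<in> (\<Inter>n\<in>{1..}. join_algebra M T P (order_past r n))"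
  \<comment> \<open>Invariance passes from the order itself to all of its translates, as the
    intersection in \<open>pinsker_eq_AE\<close> demands.\<close>
  then have "AE r in N. \<forall>g. A \<in> (\<Inter>n\<in>{1..}. join_algebra M T P (order_past (order_action g r) n))"
    by (rule AE_order_action)
  with pinsker_eq_AE[OF am P] have "AE r in N. A \<in> pinsker_algebra M T P"
    by eventually_elim blast
  \<comment> \<open>The property no longer involves the order, so holding almost surely for a
    probability measure means holding.\<close>
  then show "A \<in> pinsker_algebra M T P" by simp
qed

end

theorem theorem7p4:
  fixes M :: "'x measure"
    and T :: "'g::{group_add, countable} \<Rightarrow> 'x \<Rightarrow> 'x"
    and P :: "'x set set"
    and N :: "'g order_rel measure"
  assumes "infinite (UNIV :: 'g set)"
    and "amenable_group TYPE('g)"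
    and "standard_prob_space M"
    and "pmp_action M T"
    and "measurable_partition M P"
    and "multiorder N"
  shows "(\<forall>A. A \<in> pinsker_algebra M T P \<longleftrightarrow>
            (AE r in N. A \<in> (\<Inter>n\<in>{1..}. join_algebra M T P (order_past r n))))
       \<and> (AE r in N. pinsker_algebra M T P =
            (\<Inter>g. \<Inter>n\<in>{1..}. join_algebra M T P (order_past (order_action g r) n)))"
proof -
  interpret prob_space M using assms(4) by (simp add: pmp_action_def)
  interpret multiordered_action M T N by standard (fact assms)+
  have P: "finite_events M P" using assms(5) by (simp add: measurable_partition_def)
  show ?thesis
    using mem_pinsker_iff_AE[OF assms(2) P] pinsker_eq_AE[OF assms(2) P] by blast
qed

end
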